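(* Let $B$ and $C$ be projective plane curves with equations $F(x,y,z)=0$ and $G(x,y,z)=0$ of degrees $d$ and $\delta$ respectively, where $L_\infty$ is not a component of $B$, and let $\mathcal{C}(B,C)$ be their conchoidal transform. Then: 1. $\deg \mathcal{C}(B,C) = 2\delta d$; 2. $\mathcal{C}(B,C) = \mathcal{C}(C,B)$; 3. if $C = C_1 + C_2$ (as divisors), then $\mathcal{C}(B,C) = \mathcal{C}(B,C_1) + \mathcal{C}(B,C_2)$; 4. if $P \in L_\infty \cap B \cap C$ and the multiplicities at $P$ of $B$ and $C$ are respectively $\eta$ and $\epsilon$, then $P\in \mathcal{C}(B,C)$ with multiplicity $\geq \eta\delta + \epsilon d$, and the line $AP$ is a component of $\mathcal{C}(B,C)$ with multiplicity $\geq \epsilon(\eta -\epsilon)+\frac{\epsilon(\epsilon+1)}{2}$ if $\epsilon \leq \eta$; 5. if $A \in C$ with multiplicity $\nu$, then the divisor $\nu B$ is contained in $\mathcal{C}(B,C)$.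
   Context: $k$ is a field of characteristic $0$ or of prime characteristic greater than the degrees of the curves considered, and $\mathbf{P}^2$ is the projective plane over $k$ with homogeneous coordinates $[x:y:z]$. "Curve" means effective divisor in $\mathbf{P}^2$, given by a nonzero homogeneous polynomial (possibly reducible or non-reduced). $L_\infty$ is the line $z=0$, and $A=[0:0:1]$. $AP$ denotes the line through $A$ and $P$. Conchoidal transform: for curves $B: F=0$ of degree $d$ and $C: G=0$ of degree $\delta$, $\mathcal{C}(B,C)$ is the divisor in $\mathbf{P}^2$ defined by the resultant $R(F,G)\in k[x,y,z]$, with respect to the homogeneous variables $\lambda,\mu$, of the two binary forms in $(\lambda,\mu)$ (of degrees $d$ and $\delta$, with coefficients in $k[x,y,z]$) $$F((\mu-\lambda)x,(\mu-\lambda)y,\mu z)\quad\text{and}\quad G(\lambda x,\lambda y,\mu z).$$ *)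

theory Defs
  imports
    "Subresultants.Resultant_Prelim"
    "Berlekamp_Zassenhaus.Unique_Factorization_Poly"
begin

text \<open>
  The ring $k[x,y,z]$ is the iterated polynomial ring $k[x][y][z]$, with $x$ the innermost and
  $z$ the outermost variable.
\<close>

type_synonym 'a poly3 = "'a poly poly poly"

abbreviation (input) const3 :: "'a::comm_ring_1 \<Rightarrow> 'a poly3" where
  "const3 c \<equiv> [:[:[:c:]:]:]"

abbreviation (input) varx :: "'a::comm_ring_1 poly3" where
  "varx \<equiv> [:[:[:0, 1:]:]:]"

abbreviation (input) vary :: "'a::comm_ring_1 poly3" where
  "vary \<equiv> [:[:0, 1:]:]"

abbreviation (input) varz :: "'a::comm_ring_1 poly3" where
  "varz \<equiv> [:0, 1:]"

definition coeff3 :: "'a::comm_ring_1 poly3 \<Rightarrow> nat \<Rightarrow> nat \<Rightarrow> nat \<Rightarrow> 'a" where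
  "coeff3 F i j l = coeff (coeff (coeff F l) j) i"

text \<open>
  \<open>subst3 h F u v w\<close> is $F(u,v,w)$ for elements $u,v,w$ of a commutative ring into which the
  coefficients of $F$ are mapped by the homomorphism \<open>h\<close>.
\<close>

definition subst3 :: "('a::comm_ring_1 \<Rightarrow> 'b::comm_ring_1) \<Rightarrow> 'a poly3 \<Rightarrow> 'b \<Rightarrow> 'b \<Rightarrow> 'b \<Rightarrow> 'b" where
  "subst3 h F u v w =
     poly (map_poly (\<lambda>q. poly (map_poly (\<lambda>p. poly (map_poly h p) u) q) v) F) w"

definition homogeneous :: "nat \<Rightarrow> 'a::comm_ring_1 poly3 \<Rightarrow> bool" where
  "homogeneous d F \<longleftrightarrow> (\<forall>i j l. coeff3 F i j l \<noteq> 0 \<longrightarrow> i + j + l = d)"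

text \<open>\<open>curve d F\<close>: the equation $F = 0$ defines a plane curve (effective divisor) of degree $d$.\<close>

definition curve :: "nat \<Rightarrow> 'a::field poly3 \<Rightarrow> bool" where
  "curve d F \<longleftrightarrow> F \<noteq> 0 \<and> homogeneous d F"

text \<open>
  The divisor of $F$ is given by its coefficient at each prime divisor. A prime divisor of the plane
  is given by a prime form, unique up to a nonzero scalar, and the coefficient does not depend
  on that scalar. Non-homogeneous primes need no separate treatment: they never divide a nonzero
  form, so their coefficient is \<open>0\<close>. (The constant \<open>multiplicity\<close> of the library is not
  available here, as it requires a normalisation of units.)
\<close>

definition divisor_of :: "'a::field poly3 \<Rightarrow> 'a poly3 \<Rightarrow> nat" where
  "divisor_of F = (\<lambda>p. if prime_elem p then (GREATEST n. p ^ n dvd F) else 0)"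

text \<open>
  A point $[a:b:c]$ is represented by any triple of homogeneous coordinates.
\<close>

type_synonym 'a point = "'a \<times> 'a \<times> 'a"

definition is_point :: "'a::field point \<Rightarrow> bool" where
  "is_point P \<longleftrightarrow> P \<noteq> (0, 0, 0)"

definition on_curve :: "'a::field poly3 \<Rightarrow> 'a point \<Rightarrow> bool" where
  "on_curve F P = (case P of (a, b, c) \<Rightarrow> subst3 (\<lambda>t. t) F a b c = 0)"

text \<open>
  The affine equation of the curve $F = 0$ in a standard chart containing $P$, translated so that
  $P$ becomes the origin. Only the two affine coordinates of the chart occur in the result.
\<close>

definition local_equation :: "'a::field poly3 \<Rightarrow> 'a point \<Rightarrow> 'a poly3" where
  "local_equation F P = (case P of (a, b, c) \<Rightarrow>
     if c \<noteq> 0 then subst3 const3 F (const3 (a / c) + varx) (const3 (b / c) + vary) 1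
     else if b \<noteq> 0 then subst3 const3 F (const3 (a / b) + varx) 1 varz
     else subst3 const3 F 1 vary varz)"

definition order_at_origin :: "'a::field poly3 \<Rightarrow> nat" where
  "order_at_origin f = (LEAST n. \<exists>i j l. i + j + l = n \<and> coeff3 f i j l \<noteq> 0)"

definition mult_at :: "'a::field poly3 \<Rightarrow> 'a point \<Rightarrow> nat" where
  "mult_at F P = order_at_origin (local_equation F P)"

definition L_infty :: "'a::field poly3" where
  "L_infty = varz"

definition pt_A :: "'a::field point" where
  "pt_A = (0, 0, 1)"

text \<open>The determinant with rows $(x,y,z)$, $P$, $Q$, expanded along its first row.\<close>

definition line_through :: "'a::field point \<Rightarrow> 'a point \<Rightarrow> 'a poly3" where
  "line_through P Q = (case P of (a, b, c) \<Rightarrow> case Q of (a', b', c') \<Rightarrow>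
     const3 (b * c' - c * b') * varx + const3 (c * a' - a * c') * vary
       + const3 (a * b' - b * a') * varz)"

text \<open>
  Polynomials in $\lambda,\mu$ over a ring $R$ are elements of $R[\lambda][\mu]$. The resultant of
  binary forms of degrees $m$ and $n$ is the determinant of the Sylvester matrix of their
  dehomogenisations at $\mu = 1$, taken with the formal degrees $m$ and $n$ (so that leading
  coefficients are allowed to vanish).
\<close>

definition binary_resultant ::
    "nat \<Rightarrow> nat \<Rightarrow> 'r::comm_ring_1 poly poly \<Rightarrow> 'r poly poly \<Rightarrow> 'r" where
  "binary_resultant m n f g = det (sylvester_mat_sub m n (poly f 1) (poly g 1))"

abbreviation (input) lam :: "'r::comm_ring_1 poly poly" where
  "lam \<equiv> [:[:0, 1:]:]"

abbreviation (input) mu :: "'r::comm_ring_1 poly poly" where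
  "mu \<equiv> [:0, 1:]"

abbreviation (input) const2 :: "'r::comm_ring_1 \<Rightarrow> 'r poly poly" where
  "const2 r \<equiv> [:[:r:]:]"

text \<open>
  The form defining the conchoidal transform of the curves $F = 0$ of degree $d$ and $G = 0$ of
  degree $e$, and the transform itself.
\<close>

definition conchoidal_form :: "nat \<Rightarrow> nat \<Rightarrow> 'a::field poly3 \<Rightarrow> 'a poly3 \<Rightarrow> 'a poly3" where
  "conchoidal_form d e F G = binary_resultant d e
     (subst3 (\<lambda>c. const2 (const3 c)) F
        ((mu - lam) * const2 varx) ((mu - lam) * const2 vary) (mu * const2 varz))
     (subst3 (\<lambda>c. const2 (const3 c)) G
        (lam * const2 varx) (lam * const2 vary) (mu * const2 varz))"

definition conchoidal :: "nat \<Rightarrow> nat \<Rightarrow> 'a::field poly3 \<Rightarrow> 'a poly3 \<Rightarrow> 'a poly3 \<Rightarrow> nat" where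
  "conchoidal d e F G = divisor_of (conchoidal_form d e F G)"

end

theory Submission
  imports Defs
begin

text \<open>
  Put $f(\lambda) = F((1-\lambda)x, (1-\lambda)y, z)$ and $g(\lambda) = G(\lambda x, \lambda y, z)$.
  The form $R$ of the conchoidal transform is the Sylvester determinant of $f$ and $g$ with formal
  degrees $d$ and \<open>\<delta>\<close>. If $F = \sum_l F_l(x,y) z^l$, then $F(\lambda x, \lambda y, z)$, the
  polynomial \<open>ray F\<close>, has the coefficient $F_l z^l$ at $\lambda^{d-l}$, and $f$ arises from it by
  the flip $\lambda \mapsto 1 - \lambda$. Since $z$ does not divide $F$, the leading coefficient
  $\pm F_0$ of $f$ does not vanish; $g$ may drop in degree.

  The dependence of $R$ on $G$ is governed by one formula: if $f$ has degree exactly $d$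
  and leading coefficient $a$, then the resultant with formal degrees $d$, $e$ is $a^e$ times the
  determinant of the multiplication by $g$ on polynomials modulo $f$
  (\<open>resultant_sub_eq_det_residue_mat\<close>). So the resultant is multiplicative in $g$
  (\<open>resultant_sub_mult\<close>).

    \<^item> Homogeneity of $R$ and the lower bound for its order at a point are the same Leibniz
      argument, applied to forms of a given degree and to polynomials of at least a given order:
      both are multiplicative gradings (\<open>resultant_sub_mem\<close>).
    \<^item> $R \neq 0$: split off from $G$ the largest power of $z$, by multiplicativity, and set
      $z = 0$ in what remains. Then $f$ becomes $a(1-\lambda)^d$ and $g$ becomes
      $b\lambda^e$, whose resultant is $\pm a^e b^d$ (\<open>conchoidal_form_nonzero\<close>).
    \<^item> The flip of $\lambda$ changes the resultant by a sign only and turns $f$, $g$ into the two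
      polynomials for the pair $G$, $F$, in the opposite order; this gives the symmetry (\<open>conchoidal_form_swap\<close>).
    \<^item> In the factorial ring $k[x,y,z]$ a form is determined by its divisor up to a scalar, so
      additivity in $C$ is multiplicativity of the resultant (\<open>conchoidal_add\<close>).
    \<^item> At a point $P$ at infinity choose linear coordinates $u, v$ in $x, y$ such that $u = 0$ is
      the line $AP$. If $P$ has multiplicity \<open>\<eta>\<close> on $F$, then $u^{\eta-l}$ divides $F_l$ for $l \leq \eta$, and
      similarly for $G$ and \<open>\<epsilon>\<close>. These divisibilities cut a corner out of the Sylvester matrix, and
      weighing the terms of the determinant yields $u^{\eta\epsilon} \mid R$
      (\<open>power_dvd_resultant_sub\<close>). The exponent is at least the required
      $\epsilon(\eta-\epsilon) + \epsilon(\epsilon+1)/2$.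
    \<^item> If $A$ has multiplicity \<open>\<nu>\<close> on $G$, then $\lambda^\nu$ divides $g$, and the resultant of
      $f$ and $\lambda$ is $\pm f(0) = \pm F$ (\<open>power_dvd_conchoidal_form\<close>).
\<close>

section \<open>Resultants with formal degrees\<close>

text \<open>
  The coefficients are listed in decreasing order of degree, as in the Sylvester matrix. Products of
  matrices then express linear combinations of polynomials (\<open>mult_rows_mat\<close>).
\<close>

definition rows_mat :: "nat \<Rightarrow> (nat \<Rightarrow> 'a::comm_ring_1 poly) \<Rightarrow> 'a mat" where
  "rows_mat n p = mat n n (\<lambda>(i, j). coeff (p i) (n - 1 - j))"

lemma rows_mat_carrier [simp]: "rows_mat n p \<in> carrier_mat n n"
  by (simp add: rows_mat_def)

lemma rows_mat_dim [simp]: "dim_row (rows_mat n p) = n" "dim_col (rows_mat n p) = n"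
  by (simp_all add: rows_mat_def)

lemma rows_mat_index [simp]:
  "i < n \<Longrightarrow> j < n \<Longrightarrow> rows_mat n p $$ (i, j) = coeff (p i) (n - 1 - j)"
  by (simp add: rows_mat_def)

lemma mult_rows_mat:
  assumes "A \<in> carrier_mat n n"
  shows "A * rows_mat n p = rows_mat n (\<lambda>i. \<Sum>k<n. smult (A $$ (i, k)) (p k))"
  using assms by (intro eq_matI) (auto simp: scalar_prod_def coeff_sum lessThan_atLeast0)

lemma poly_eq_sum_rev:
  fixes p :: "'a::comm_ring_1 poly"
  assumes "\<And>m. n \<le> m \<Longrightarrow> coeff p m = 0"
  shows "(\<Sum>k<n. smult (coeff p (n - 1 - k)) (monom 1 (n - 1 - k))) = p"
proof -
  have "(\<Sum>k<n. smult (coeff p (n - 1 - k)) (monom 1 (n - 1 - k)))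
      = (\<Sum>k<n. monom (coeff p k) k)"
    by (rule sum.reindex_bij_witness[of _ "\<lambda>k. n - 1 - k" "\<lambda>k. n - 1 - k"])
      (auto simp: smult_monom)
  also have "\<dots> = p"
    using assms by (auto intro!: poly_eqI simp: coeff_sum linorder_not_less)
  finally show ?thesis .
qed

text \<open>
  The degree bounds matter: the Sylvester matrix cuts off coefficients beyond the formal degrees.
\<close>

lemma sylvester_mat_sub_eq_rows_mat:
  fixes f g :: "'a::comm_ring_1 poly"
  assumes "degree f \<le> d" and "degree g \<le> e"
  shows "sylvester_mat_sub d e f g
    = rows_mat (d + e) (\<lambda>i. if i < e then monom 1 (e - 1 - i) * f else monom 1 (d + e - 1 - i) * g)"
proof (rule eq_matI)
  fix i j
  assume "i < dim_row (rows_mat (d + e)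
      (\<lambda>i. if i < e then monom 1 (e - 1 - i) * f else monom 1 (d + e - 1 - i) * g))"
    and "j < dim_col (rows_mat (d + e)
      (\<lambda>i. if i < e then monom 1 (e - 1 - i) * f else monom 1 (d + e - 1 - i) * g))"
  then have ij: "i < d + e" "j < d + e" by auto
  have f0: "coeff f k = 0" if "k > d" for k
    using assms that by (intro coeff_eq_0) auto
  have g0: "coeff g k = 0" if "k > e" for k
    using assms that by (intro coeff_eq_0) auto
  have eqs: "d + e - 1 - j - (e - 1 - i) = d + i - j" if "i < e"
    using ij that by auto
  have eqs2: "d + e - 1 - j - (d + e - 1 - i) = i - j"
    using ij by auto
  show "sylvester_mat_sub d e f g $$ (i, j) = rows_mat (d + e)
      (\<lambda>i. if i < e then monom 1 (e - 1 - i) * f else monom 1 (d + e - 1 - i) * g) $$ (i, j)"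
    using ij f0[of "d + i - j"] g0[of "i - j"]
    by (auto simp: sylvester_mat_sub_index coeff_monom_mult eqs eqs2)
qed auto

text \<open>
  The matrix of the multiplication by \<open>g\<close> on the polynomials modulo \<open>f\<close>, with respect to the powers of
  the variable.
\<close>

definition residue_mat :: "'a::field poly \<Rightarrow> 'a poly \<Rightarrow> 'a mat" where
  "residue_mat f g = rows_mat (degree f) (\<lambda>i. (monom 1 (degree f - 1 - i) * g) mod f)"

lemma mod_sum_poly: "(\<Sum>i\<in>A. f i) mod (p::'a::field poly) = (\<Sum>i\<in>A. f i mod p)"
  by (induction A rule: infinite_finite_induct) (auto simp: poly_mod_add_left)

lemma residue_mat_mult:
  fixes f g h :: "'a::field poly"
  assumes "f \<noteq> 0"
  shows "residue_mat f (g * h) = residue_mat f g * residue_mat f h"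
proof -
  define d where "d = degree f"
  have "(\<Sum>k<d. smult (residue_mat f g $$ (i, k)) ((monom 1 (d - 1 - k) * h) mod f))
      = (monom 1 (d - 1 - i) * (g * h)) mod f" if i: "i < d" for i
  proof -
    let ?r = "(monom 1 (d - 1 - i) * g) mod f"
    have "f = 0 \<or> ?r = 0 \<or> degree ?r < d"
      unfolding d_def using assms degree_mod_less' by blast
    then have r: "coeff ?r m = 0" if "d \<le> m" for m
      using that assms by (auto intro: coeff_eq_0)
    have "(\<Sum>k<d. smult (residue_mat f g $$ (i, k)) ((monom 1 (d - 1 - k) * h) mod f))
        = (\<Sum>k<d. smult (coeff ?r (d - 1 - k)) (monom 1 (d - 1 - k)) * h mod f)"
      using i by (intro sum.cong) (auto simp: residue_mat_def d_def mod_smult_left)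
    also have "\<dots> = (\<Sum>k<d. smult (coeff ?r (d - 1 - k)) (monom 1 (d - 1 - k))) * h mod f"
      by (simp add: sum_distrib_right mod_sum_poly)
    also have "\<dots> = ?r * h mod f"
      by (subst poly_eq_sum_rev) (use r in auto)
    finally show ?thesis
      by (simp add: mod_mult_left_eq mult.assoc)
  qed
  then show ?thesis
    unfolding residue_mat_def[of f h] d_def[symmetric]
    by (subst mult_rows_mat) (auto simp: residue_mat_def d_def rows_mat_def intro!: eq_matI)
qed

text \<open>
  Divide the shifted copies $X^i g$ by $f$ with remainder. The rows of the Sylvester matrix become
  combinations of the polynomials $X^i f$ with $i < e$ and $X^i$ with $i < d$. The latter form a triangular
  matrix of determinant $a^e$, where $a$ is the leading coefficient of $f$, and the combining matrix is
  block triangular with the blocks $1$ and the matrix of remainders.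
\<close>

lemma resultant_sub_eq_det_residue_mat:
  fixes f g :: "'a::field poly"
  assumes f: "f \<noteq> 0" and d: "degree f = d" and g: "degree g \<le> e"
  shows "resultant_sub d e f g = lead_coeff f ^ e * det (residue_mat f g)"
proof -
  define h where "h = (\<lambda>i. if i < e then monom 1 (e - 1 - i) * f else monom 1 (d + e - 1 - i))"
  define q where "q = (\<lambda>i. (monom 1 (d - 1 - i) * g) div f)"
  define r where "r = (\<lambda>i. (monom 1 (d - 1 - i) * g) mod f)"
  define Q where "Q = mat d e (\<lambda>(i, k). coeff (q i) (e - 1 - k))"
  (* combining matrix: the rows below the first e hold quotients and remainders *)
  define A where "A = four_block_mat (1\<^sub>m e) (0\<^sub>m e d) Q (residue_mat f g)"
  have Rc: "residue_mat f g \<in> carrier_mat d d"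
    by (simp add: residue_mat_def d)
  have A: "A \<in> carrier_mat (d + e) (d + e)"
    unfolding A_def using Rc by (auto simp: Q_def add.commute)
  have rows: "(\<Sum>k<d + e. smult (A $$ (i, k)) (h k))
      = (if i < e then monom 1 (e - 1 - i) * f else monom 1 (d + e - 1 - i) * g)"
    if i: "i < d + e" for i
  proof (cases "i < e")
    case True
    have "(\<Sum>k<d + e. smult (A $$ (i, k)) (h k)) = (\<Sum>k<d + e. if k = i then h k else 0)"
      using True i Rc by (intro sum.cong) (auto simp: A_def Q_def)
    also have "\<dots> = h i"
      using i by simp
    finally show ?thesis
      using True by (simp add: h_def)
  next
    case False
    define i' where "i' = i - e"
    have i': "i' < d" "i = e + i'"
      using False i by (auto simp: i'_def)
    have "degree (monom 1 (d - 1 - i') * g) \<le> d - 1 + e"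
      by (rule order_trans[OF degree_mult_le]) (use g degree_monom_le[of "1::'a" "d - 1 - i'"] in linarith)
    have "r i' = 0 \<or> degree (r i') < d"
      unfolding d[symmetric] r_def using f degree_mod_less' by blast
    then have r0: "coeff (r i') m = 0" if "d \<le> m" for m
      using that by (auto intro: coeff_eq_0)
    have "q i' * f = monom 1 (d - 1 - i') * g - r i'"
      by (simp add: q_def r_def minus_mod_eq_div_mult)
    also have "degree (monom 1 (d - 1 - i') * g - r i') < d + e"
      using \<open>degree (monom 1 (d - 1 - i') * g) \<le> d - 1 + e\<close> \<open>r i' = 0 \<or> degree (r i') < d\<close> i'
      by (intro degree_diff_less) auto
    finally have "q i' = 0 \<or> degree (q i') < e"
      using f d by (cases "q i' = 0") (auto simp: degree_mult_eq)
    then have q0: "coeff (q i') m = 0" if "e \<le> m" for m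
      using that by (auto intro: coeff_eq_0)
    have "(\<Sum>k<d + e. smult (A $$ (i, k)) (h k))
        = (\<Sum>k<e. smult (A $$ (i, k)) (h k)) + (\<Sum>k<d. smult (A $$ (i, e + k)) (h (e + k)))"
      using sum.atLeastLessThan_concat[of 0 e "e + d" "\<lambda>k. smult (A $$ (i, k)) (h k)"]
        sum.shift_bounds_nat_ivl[of "\<lambda>k. smult (A $$ (i, k)) (h k)" 0 e d]
      by (simp add: lessThan_atLeast0 add.commute)
    also have "(\<Sum>k<e. smult (A $$ (i, k)) (h k))
        = (\<Sum>k<e. smult (coeff (q i') (e - 1 - k)) (monom 1 (e - 1 - k)) * f)"
      using i' Rc by (intro sum.cong) (auto simp: A_def Q_def h_def)
    also have "\<dots> = q i' * f"
      unfolding sum_distrib_right[symmetric] by (subst poly_eq_sum_rev) (use q0 in auto)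
    also have "(\<Sum>k<d. smult (A $$ (i, e + k)) (h (e + k)))
        = (\<Sum>k<d. smult (coeff (r i') (d - 1 - k)) (monom 1 (d - 1 - k)))"
      using i' Rc by (intro sum.cong) (auto simp: A_def Q_def h_def residue_mat_def d r_def)
    also have "\<dots> = r i'"
      by (rule poly_eq_sum_rev) (use r0 in auto)
    also have "q i' * f + r i' = monom 1 (d - 1 - i') * g"
      by (simp add: q_def r_def)
    finally show ?thesis
      using i' by simp
  qed
  have "sylvester_mat_sub d e f g = A * rows_mat (d + e) h"
    using rows by (auto simp: sylvester_mat_sub_eq_rows_mat d g mult_rows_mat[OF A] intro!: eq_matI)
  then have "resultant_sub d e f g = det A * det (rows_mat (d + e) h)"
    by (simp add: resultant_sub_def det_mult[OF A rows_mat_carrier])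
  also have "det A = det (residue_mat f g)"
    unfolding A_def using Rc by (subst det_four_block_mat_upper_right_zero[of _ e _ d]) (auto simp: Q_def)
  also have "det (rows_mat (d + e) h) = lead_coeff f ^ e"
  proof -
    have f0: "coeff f m = 0" if "m > d" for m
      using that d by (auto intro: coeff_eq_0)
    have "upper_triangular (rows_mat (d + e) h)"
      by (auto simp: upper_triangular_def h_def coeff_monom_mult intro!: f0)
    then have "det (rows_mat (d + e) h) = prod_list (diag_mat (rows_mat (d + e) h))"
      by (rule det_upper_triangular) (rule rows_mat_carrier)
    also have "\<dots> = (\<Prod>i<d + e. coeff (h i) (d + e - 1 - i))"
      by (simp add: prod_list_diag_prod lessThan_atLeast0)
    also have "\<dots> = (\<Prod>i<d + e. if i < e then lead_coeff f else 1)"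
    proof (intro prod.cong refl)
      fix i assume "i \<in> {..<d + e}"
      moreover have "d + e - 1 - i - (e - 1 - i) = d" if "i < e"
        using that by simp
      ultimately show "coeff (h i) (d + e - 1 - i) = (if i < e then lead_coeff f else 1)"
        by (auto simp: h_def coeff_monom_mult d)
    qed
    also have "\<dots> = (\<Prod>i<e. lead_coeff f)"
      by (intro prod.mono_neutral_cong_right) auto
    finally show ?thesis by simp
  qed
  finally show ?thesis
    by (simp add: mult.commute)
qed

lemma resultant_sub_map_poly:
  assumes "comm_ring_hom h"
  shows "h (resultant_sub d e f g) = resultant_sub d e (map_poly h f) (map_poly h g)"
proof -
  interpret comm_ring_hom h by fact
  have "map_mat h (sylvester_mat_sub d e f g) = sylvester_mat_sub d e (map_poly h f) (map_poly h g)"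
    by (rule sylvester_mat_sub_map) (rule hom_zero)
  then show ?thesis
    unfolding resultant_sub_def by (metis hom_det)
qed

text \<open>
  Division with remainder needs a field, while the coefficients here are polynomials. The formula is
  therefore read in the field of fractions.
\<close>

lemma to_fract_resultant_sub:
  fixes f g :: "'a::idom poly"
  assumes "f \<noteq> 0" and "degree f = d" and "degree g \<le> e"
  shows "to_fract (resultant_sub d e f g)
    = to_fract (lead_coeff f) ^ e * det (residue_mat (fract_poly f) (fract_poly g))"
proof -
  have hom: "comm_ring_hom (to_fract :: 'a \<Rightarrow> _)"
    by unfold_locales auto
  have deg: "degree (fract_poly p) = degree p" for p :: "'a poly"
    by (rule degree_map_poly) simp
  show ?thesis
    unfolding resultant_sub_map_poly[OF hom]
    using assms resultant_sub_eq_det_residue_mat[of "fract_poly f" d "fract_poly g" e]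
    by (simp add: deg coeff_map_poly)
qed

text \<open>
  Up to the power of the leading coefficient of $f$ the resultant is the determinant of a
  multiplication map, and such maps compose. The formal degree of a factor may exceed its actual degree.
\<close>

lemma resultant_sub_mult:
  fixes f g h :: "'a::idom poly"
  assumes f: "f \<noteq> 0" "degree f = d" and g: "degree g \<le> e" and h: "degree h \<le> e'"
  shows "resultant_sub d (e + e') f (g * h) = resultant_sub d e f g * resultant_sub d e' f h"
proof -
  have gh: "degree (g * h) \<le> e + e'"
    using degree_mult_le[of g h] g h by linarith
  have deg: "degree (fract_poly f) = d"
    using f by (subst degree_map_poly) auto
  have "det (residue_mat (fract_poly f) (fract_poly g * fract_poly h))
      = det (residue_mat (fract_poly f) (fract_poly g)) * det (residue_mat (fract_poly f) (fract_poly h))"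
    using f by (subst residue_mat_mult, simp, intro det_mult[of _ d]) (simp_all add: residue_mat_def deg)
  then have "to_fract (resultant_sub d (e + e') f (g * h))
      = to_fract (resultant_sub d e f g) * to_fract (resultant_sub d e' f h)"
    by (simp add: to_fract_resultant_sub[OF f g] to_fract_resultant_sub[OF f h]
        to_fract_resultant_sub[OF f gh] power_add)
  then show ?thesis
    by (simp only: to_fract_mult[symmetric] to_fract_eq_iff)
qed

lemma resultant_sub_const:
  fixes f :: "'a::idom poly"
  assumes f: "f \<noteq> 0" "degree f = d"
  shows "resultant_sub d k f [:c:] = lead_coeff f ^ k * c ^ d"
proof -
  let ?c = "to_fract c"
  have deg: "degree (fract_poly f) = d"
    using f by (subst degree_map_poly) auto
  have "residue_mat (fract_poly f) [:?c:] = ?c \<cdot>\<^sub>m 1\<^sub>m d"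
  proof (rule eq_matI)
    fix i j assume "i < dim_row (?c \<cdot>\<^sub>m 1\<^sub>m d)" "j < dim_col (?c \<cdot>\<^sub>m 1\<^sub>m d)"
    then have ij: "i < d" "j < d" by auto
    have m: "monom 1 (d - 1 - i) * [:?c:] = monom ?c (d - 1 - i)"
      by (simp add: smult_monom)
    have "degree (monom ?c (d - 1 - i)) < degree (fract_poly f)"
      using degree_monom_le[of ?c "d - 1 - i"] ij deg by simp
    then have "monom ?c (d - 1 - i) mod fract_poly f = monom ?c (d - 1 - i)"
      by (rule mod_poly_less)
    then have "residue_mat (fract_poly f) [:?c:] $$ (i, j) = coeff (monom ?c (d - 1 - i)) (d - 1 - j)"
      unfolding residue_mat_def deg using ij by (simp only: rows_mat_index m)
    then show "residue_mat (fract_poly f) [:?c:] $$ (i, j) = (?c \<cdot>\<^sub>m 1\<^sub>m d) $$ (i, j)"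
      using ij by auto
  qed (simp_all add: residue_mat_def f(2))
  then have "to_fract (resultant_sub d k f [:c:]) = to_fract (lead_coeff f) ^ k * ?c ^ d"
    using to_fract_resultant_sub[of f d "[:c:]" k] f by (simp add: to_fract_hom.map_poly_pCons_hom)
  also have "\<dots> = to_fract (lead_coeff f ^ k * c ^ d)"
    by (simp add: to_fract_hom.hom_power)
  finally show ?thesis
    by (simp only: to_fract_eq_iff)
qed

text \<open>
  Signs of determinants are irrelevant for divisors; this relation avoids their bookkeeping.
\<close>

definition eq_up_to_sign :: "'a::comm_ring_1 \<Rightarrow> 'a \<Rightarrow> bool" where
  "eq_up_to_sign a b \<longleftrightarrow> a = b \<or> a = - b"

lemma eq_up_to_sign_trans: "eq_up_to_sign a b \<Longrightarrow> eq_up_to_sign b c \<Longrightarrow> eq_up_to_sign a c"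
  by (auto simp: eq_up_to_sign_def)

lemma eq_up_to_sign_sym: "eq_up_to_sign a b \<Longrightarrow> eq_up_to_sign b a"
  by (auto simp: eq_up_to_sign_def)

lemma eq_up_to_sign_mult: "eq_up_to_sign a b \<Longrightarrow> eq_up_to_sign c d \<Longrightarrow> eq_up_to_sign (a * c) (b * d)"
  by (auto simp: eq_up_to_sign_def)

lemma resultant_sub_swap:
  fixes f g :: "'a::comm_ring_1 poly"
  assumes "degree f \<le> d" and "degree g \<le> e"
  shows "eq_up_to_sign (resultant_sub d e f g) (resultant_sub e d g f)"
proof -
  (* moves the d rows of g in front of the e rows of f *)
  define \<pi> where "\<pi> = (\<lambda>i. if i < d then e + i else if i < d + e then i - d else i)"
  have \<pi>: "\<pi> permutes {0..<d + e}"
  proof (rule bij_imp_permutes)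
    show "bij_betw \<pi> {0..<d + e} {0..<d + e}"
      by (rule bij_betw_byWitness[of _ "\<lambda>i. if i < e then d + i else i - e"])
        (auto simp: \<pi>_def split: if_splits)
  qed (auto simp: \<pi>_def)
  let ?S = "sylvester_mat_sub d e f g"
  have "sylvester_mat_sub e d g f = mat (d + e) (d + e) (\<lambda>(i, j). ?S $$ (\<pi> i, j))"
    using assms
    by (intro eq_matI) (auto simp: sylvester_mat_sub_eq_rows_mat \<pi>_def add.commute intro!: arg_cong2[of _ _ _ _ coeff])
  then have "resultant_sub e d g f = signof \<pi> * resultant_sub d e f g"
    unfolding resultant_sub_def
    by (subst det_permute_rows[OF _ \<pi>, symmetric]) auto
  then show ?thesis
    by (auto simp: eq_up_to_sign_def sign_def split: if_splits)
qed

text \<open>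
  Modulo $X$ the multiplication by $f$ is the $1 \times 1$ matrix $f(0)$; this computes the resultant with
  exchanged arguments.
\<close>

lemma resultant_sub_X:
  fixes f :: "'a::idom poly"
  assumes "degree f \<le> d"
  shows "eq_up_to_sign (resultant_sub d 1 f [:0, 1:]) (coeff f 0)"
proof -
  let ?X = "[:0, 1:] :: 'a fract poly"
  obtain a q where aq: "fract_poly f = pCons a q"
    by (cases "fract_poly f")
  have "fract_poly f = [:a:] + q * ?X"
    by (simp add: aq)
  then have "fract_poly f mod ?X = [:a:] mod ?X"
    by (metis mod_mult_self1)
  then have "fract_poly f mod ?X = [:a:]"
    by (simp add: mod_poly_less)
  moreover have "a = to_fract (coeff f 0)"
    using aq by (metis coeff_map_poly coeff_pCons_0 to_fract_0)
  ultimately have "residue_mat ?X (fract_poly f) = mat 1 1 (\<lambda>_. to_fract (coeff f 0))"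
    by (intro eq_matI) (auto simp: residue_mat_def)
  then have "to_fract (resultant_sub 1 d [:0, 1:] f) = to_fract (coeff f 0)"
    using assms by (subst to_fract_resultant_sub) (auto simp: map_poly_pCons det_single)
  then have "resultant_sub 1 d [:0, 1:] f = coeff f 0"
    by (simp only: to_fract_eq_iff)
  then show ?thesis
    using resultant_sub_swap[of f d "[:0, 1:]" 1] assms by simp
qed

text \<open>
  The matrix of the substitution $X \mapsto 1 - X$ on polynomials of degree less than \<open>n\<close>.
\<close>

definition flip_mat :: "nat \<Rightarrow> 'a::comm_ring_1 mat" where
  "flip_mat n = rows_mat n (\<lambda>i. [:1, - 1:] ^ (n - 1 - i))"

lemma degree_flip_power: "degree ([:1, - 1:] ^ k :: 'a::comm_ring_1 poly) \<le> k"
proof -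
  have "degree [:1, - 1::'a:] * k \<le> 1 * k"
    by (intro mult_right_mono) simp_all
  then show ?thesis
    using degree_power_le[of "[:1, - 1::'a:]" k] by linarith
qed

lemma det_flip_mat: "eq_up_to_sign (det (flip_mat n)) 1"
proof -
  have deg: "degree ([:1, - 1:] ^ k :: 'a poly) \<le> k" for k
    by (rule degree_flip_power)
  have top: "coeff ([:1, - 1:] ^ k :: 'a poly) k = (- 1) ^ k" for k
  proof (induction k)
    case (Suc k)
    have "coeff ([:1, - 1:] ^ k :: 'a poly) (Suc k) = 0"
      using deg[of k] by (intro coeff_eq_0) auto
    then show ?case using Suc by simp
  qed simp
  have "upper_triangular (flip_mat n :: 'a mat)"
    unfolding upper_triangular_def
  proof (intro allI impI)
    fix i j assume "i < dim_row (flip_mat n :: 'a mat)" "j < i"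
    then show "(flip_mat n :: 'a mat) $$ (i, j) = 0"
      using deg[of "n - 1 - i"] by (auto simp: flip_mat_def intro!: coeff_eq_0)
  qed
  then have "det (flip_mat n :: 'a mat) = prod_list (diag_mat (flip_mat n))"
    by (rule det_upper_triangular[of _ n]) (simp add: flip_mat_def)
  also have "\<dots> = (\<Prod>i<n. (- 1) ^ (n - 1 - i))"
    by (simp add: prod_list_diag_prod lessThan_atLeast0 flip_mat_def top)
  also have "\<dots> = (- 1) ^ (\<Sum>i<n. n - 1 - i)"
    by (simp add: power_sum)
  also have "eq_up_to_sign \<dots> (1::'a)"
    by (cases "even (\<Sum>i<n. n - 1 - i)") (simp_all add: eq_up_to_sign_def)
  finally show ?thesis .
qed

lemma rows_mat_mult_flip_mat:
  assumes "\<And>i. i < n \<Longrightarrow> degree (p i) < n"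
  shows "rows_mat n p * flip_mat n = rows_mat n (\<lambda>i. p i \<circ>\<^sub>p [:1, - 1:])"
proof -
  have "(\<Sum>k<n. smult (rows_mat n p $$ (i, k)) ([:1, - 1:] ^ (n - 1 - k))) = p i \<circ>\<^sub>p [:1, - 1:]"
    if i: "i < n" for i
  proof -
    have "p i = (\<Sum>k<n. smult (coeff (p i) (n - 1 - k)) (monom 1 (n - 1 - k)))"
      using assms[OF i] by (intro poly_eq_sum_rev[symmetric] coeff_eq_0) auto
    then have "p i \<circ>\<^sub>p [:1, - 1:] = (\<Sum>k<n. smult (coeff (p i) (n - 1 - k)) (monom 1 (n - 1 - k))) \<circ>\<^sub>p [:1, - 1:]"
      by simp
    also have "\<dots> = (\<Sum>k<n. smult (coeff (p i) (n - 1 - k)) ([:1, - 1:] ^ (n - 1 - k)))"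
      by (simp add: pcompose_sum pcompose_smult monom_altdef pcompose_hom.hom_power pcompose_pCons)
    also have "\<dots> = (\<Sum>k<n. smult (rows_mat n p $$ (i, k)) ([:1, - 1:] ^ (n - 1 - k)))"
      using i by (intro sum.cong) auto
    finally show ?thesis by simp
  qed
  then show ?thesis
    unfolding flip_mat_def by (subst mult_rows_mat) (auto intro!: eq_matI)
qed

text \<open>
  The substitution $X \mapsto 1 - X$ acts on the columns of the Sylvester matrix by a matrix \<open>flip_mat\<close>.
  It turns $X^i f$ into $(1-X)^i$ times the flipped $f$, so the same effect is obtained by
  acting on the two blocks of rows of the Sylvester matrix of the flipped polynomials. All these matrices have
  determinant $\pm 1$.
\<close>

lemma resultant_sub_flip:
  fixes f g :: "'a::idom poly"
  assumes f: "degree f \<le> d" and g: "degree g \<le> e"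
  shows "eq_up_to_sign (resultant_sub d e (f \<circ>\<^sub>p [:1, - 1:]) (g \<circ>\<^sub>p [:1, - 1:])) (resultant_sub d e f g)"
proof -
  let ?c = "\<lambda>p. p \<circ>\<^sub>p [:1, - 1::'a:]"
  have dc: "degree (?c p) \<le> degree p" for p :: "'a poly"
    using degree_pcompose_le[of p "[:1, - 1:]"] by simp
  define p where "p = (\<lambda>i. if i < e then monom 1 (e - 1 - i) * f else monom 1 (d + e - 1 - i) * g)"
  define p' where "p' = (\<lambda>i. if i < e then monom 1 (e - 1 - i) * ?c f else monom 1 (d + e - 1 - i) * ?c g)"
  define A where "A = four_block_mat (flip_mat e) (0\<^sub>m e d) (0\<^sub>m d e) (flip_mat d :: 'a mat)"
  have fc: "flip_mat n \<in> carrier_mat n n" for n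
    by (simp add: flip_mat_def)
  have fd: "dim_row (flip_mat n) = n" "dim_col (flip_mat n) = n" for n
    by (simp_all add: flip_mat_def)
  have A: "A \<in> carrier_mat (d + e) (d + e)"
    unfolding A_def add.commute[of d e] by (rule four_block_carrier_mat[OF fc fc])
  have "degree (p i) < d + e" if "i < d + e" for i
    using that f g degree_mult_le[of "monom (1::'a) (e - 1 - i)" f] degree_mult_le[of "monom (1::'a) (d + e - 1 - i)" g]
      degree_monom_le[of "1::'a" "e - 1 - i"] degree_monom_le[of "1::'a" "d + e - 1 - i"]
    by (auto simp: p_def)
  then have "rows_mat (d + e) p * flip_mat (d + e) = rows_mat (d + e) (\<lambda>i. ?c (p i))"
    by (rule rows_mat_mult_flip_mat)
  also have "\<dots> = A * rows_mat (d + e) p'"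
  proof -
    have pow: "?c (monom 1 m * q) = [:1, - 1:] ^ m * ?c q" for m q
      by (simp add: pcompose_mult monom_altdef pcompose_hom.hom_power pcompose_pCons)
    have expand: "(\<Sum>k<n. smult ((flip_mat n :: 'a mat) $$ (i, k)) (monom 1 (n - 1 - k))) = [:1, - 1:] ^ (n - 1 - i)"
      if "i < n" for n i
    proof -
      have "degree ([:1, - 1::'a:] ^ (n - 1 - i)) < n"
        using degree_flip_power[of "n - 1 - i", where 'a = 'a] that by simp
      then have "(\<Sum>k<n. smult (coeff ([:1, - 1:] ^ (n - 1 - i)) (n - 1 - k)) (monom 1 (n - 1 - k)))
          = [:1, - 1::'a:] ^ (n - 1 - i)"
        by (intro poly_eq_sum_rev coeff_eq_0) simp
      then show ?thesis
        using that by (simp add: flip_mat_def)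
    qed
    have "(\<Sum>k<d + e. smult (A $$ (i, k)) (p' k)) = ?c (p i)" if i: "i < d + e" for i
    proof -
      have "(\<Sum>k<d + e. smult (A $$ (i, k)) (p' k))
          = (\<Sum>k<e. smult (A $$ (i, k)) (p' k)) + (\<Sum>k<d. smult (A $$ (i, e + k)) (p' (e + k)))"
        using sum.atLeastLessThan_concat[of 0 e "e + d" "\<lambda>k. smult (A $$ (i, k)) (p' k)"]
          sum.shift_bounds_nat_ivl[of "\<lambda>k. smult (A $$ (i, k)) (p' k)" 0 e d]
        by (simp add: lessThan_atLeast0 add.commute)
      also have "(\<Sum>k<e. smult (A $$ (i, k)) (p' k))
          = (if i < e then (\<Sum>k<e. smult (flip_mat e $$ (i, k)) (monom 1 (e - 1 - k))) * ?c f else 0)"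
        using i by (auto simp: A_def p'_def fd sum_distrib_right intro!: sum.cong sum.neutral)
      also have "(\<Sum>k<d. smult (A $$ (i, e + k)) (p' (e + k)))
          = (if i < e then 0
             else (\<Sum>k<d. smult (flip_mat d $$ (i - e, k)) (monom 1 (d - 1 - k))) * ?c g)"
        using i by (auto simp: A_def p'_def fd sum_distrib_right intro!: sum.cong sum.neutral)
      finally show ?thesis
        using i expand[of i e] expand[of "i - e" d] by (auto simp: p_def pow Suc_diff_le)
    qed
    then show ?thesis
      unfolding mult_rows_mat[OF A] by (intro eq_matI) auto
  qed
  finally have "det (rows_mat (d + e) p) * det (flip_mat (d + e)) = det A * det (rows_mat (d + e) p')"
    using det_mult[OF rows_mat_carrier fc, of "d + e" p] det_mult[OF A rows_mat_carrier, of p'] by simp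
  moreover have "det A = det (flip_mat e) * det (flip_mat d :: 'a mat)"
    unfolding A_def by (rule det_four_block_mat_upper_right_zero[of _ e _ d]) (simp_all add: fc)
  ultimately have "eq_up_to_sign (det (rows_mat (d + e) p)) (det (rows_mat (d + e) p'))"
    using det_flip_mat[of e, where 'a = 'a] det_flip_mat[of d, where 'a = 'a] det_flip_mat[of "d + e", where 'a = 'a]
    by (auto simp: eq_up_to_sign_def minus_equation_iff[of "det (rows_mat (d + e) p)"])
  moreover have "resultant_sub d e f g = det (rows_mat (d + e) p)"
    unfolding resultant_sub_def p_def using sylvester_mat_sub_eq_rows_mat[OF f g] by simp
  moreover have "resultant_sub d e (?c f) (?c g) = det (rows_mat (d + e) p')"
    unfolding resultant_sub_def p'_def
    using sylvester_mat_sub_eq_rows_mat[OF order_trans[OF dc f] order_trans[OF dc g]] by simp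
  ultimately show ?thesis
    by (auto simp: eq_up_to_sign_def)
qed

lemma resultant_sub_X_power:
  fixes f :: "'a::idom poly"
  assumes f: "f \<noteq> 0" "degree f = d"
  shows "eq_up_to_sign (resultant_sub d n f ([:0, 1:] ^ n)) (coeff f 0 ^ n)"
proof (induction n)
  case 0
  then show ?case
    using resultant_sub_const[OF f, of 0 1] by (simp add: eq_up_to_sign_def flip: pCons_one)
next
  case (Suc n)
  have "resultant_sub d (1 + n) f ([:0, 1:] * [:0, 1:] ^ n)
      = resultant_sub d 1 f [:0, 1:] * resultant_sub d n f ([:0, 1:] ^ n)"
    using f degree_power_le[of "[:0, 1::'a:]" n] by (intro resultant_sub_mult) auto
  then show ?case
    using eq_up_to_sign_mult[OF resultant_sub_X[of f d] Suc] f by simp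
qed

section \<open>Determinants with graded entries\<close>

text \<open>
  Used for forms of degree \<open>n\<close>, for polynomials of order at least \<open>n\<close>, and for multiples of
  the \<open>n\<close>-th power of an element. The sets for distinct \<open>n\<close> need not be disjoint.
\<close>

locale multiplicative_grading =
  fixes S :: "nat \<Rightarrow> 'a::comm_ring_1 set"
  assumes zero: "0 \<in> S n"
    and one: "1 \<in> S 0"
    and add: "a \<in> S n \<Longrightarrow> b \<in> S n \<Longrightarrow> a + b \<in> S n"
    and minus: "a \<in> S n \<Longrightarrow> - a \<in> S n"
    and mult: "a \<in> S m \<Longrightarrow> b \<in> S n \<Longrightarrow> a * b \<in> S (m + n)"
begin

lemma sum: "(\<And>i. i \<in> A \<Longrightarrow> f i \<in> S n) \<Longrightarrow> (\<Sum>i\<in>A. f i) \<in> S n"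
  by (induction A rule: infinite_finite_induct) (auto intro: zero add)

lemma prod: "(\<And>i. i \<in> A \<Longrightarrow> f i \<in> S (w i)) \<Longrightarrow> (\<Prod>i\<in>A. f i) \<in> S (\<Sum>i\<in>A. w i)"
  by (induction A rule: infinite_finite_induct) (auto intro: one mult)

lemma det_mem:
  assumes M: "M \<in> carrier_mat n n"
    and entry: "\<And>i j. i < n \<Longrightarrow> j < n \<Longrightarrow> M $$ (i, j) \<in> S (w i j)"
    and weight: "\<And>\<sigma>. \<sigma> permutes {0..<n} \<Longrightarrow> S (\<Sum>i<n. w i (\<sigma> i)) \<subseteq> S N"
  shows "det M \<in> S N"
proof -
  have "signof \<sigma> * (\<Prod>i = 0..<n. M $$ (i, \<sigma> i)) \<in> S N" if \<sigma>: "\<sigma> permutes {0..<n}" for \<sigma>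
  proof -
    have "M $$ (i, \<sigma> i) \<in> S (w i (\<sigma> i))" if "i \<in> {0..<n}" for i
      using entry[of i "\<sigma> i"] that permutes_in_image[OF \<sigma>, of i] by simp
    then have "(\<Prod>i = 0..<n. M $$ (i, \<sigma> i)) \<in> S (\<Sum>i = 0..<n. w i (\<sigma> i))"
      by (rule prod)
    then have "(\<Prod>i = 0..<n. M $$ (i, \<sigma> i)) \<in> S N"
      using weight[OF \<sigma>] by (auto simp: lessThan_atLeast0)
    then show ?thesis
      using minus by (auto simp: sign_def)
  qed
  then show ?thesis
    unfolding det_def'[OF M] by (intro sum) auto
qed

lemma resultant_sub_mem:
  assumes f: "\<And>k. coeff f k \<in> S a" and g: "\<And>k. coeff g k \<in> S b"
  shows "resultant_sub d e f g \<in> S (e * a + d * b)"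
proof -
  define w where "w = (\<lambda>i (j::nat). if i < e then a else b)"
  have "(\<Sum>i<d + e. w i (\<sigma> i)) = e * a + d * b" for \<sigma> :: "nat \<Rightarrow> nat"
  proof -
    have "(\<Sum>i<d + e. w i (\<sigma> i)) = (\<Sum>i<e. w i (\<sigma> i)) + (\<Sum>i=e..<e + d. w i (\<sigma> i))"
      using sum.atLeastLessThan_concat[of 0 e "e + d" "\<lambda>i. w i (\<sigma> i)"]
      by (simp add: lessThan_atLeast0 add.commute)
    then show ?thesis
      by (simp add: w_def)
  qed
  then show ?thesis
    unfolding resultant_sub_def
    by (intro det_mem[of _ "d + e" w])
      (use f g zero in \<open>auto simp: sylvester_mat_sub_index w_def\<close>)
qed

end

section \<open>Substitution into ternary polynomials\<close>

text \<open>
  Otherwise the simplifier rewrites $[:1:]$ to $1$ inside the variables of iterated polynomial rings, and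
  facts about the variables no longer match.
\<close>

declare coeff_lift_hom.hom_one [simp del]

lemma comm_ring_hom_ident: "comm_ring_hom (\<lambda>c::'a::comm_ring_1. c)"
  by unfold_locales simp_all

lemma comm_ring_hom_poly_map_poly:
  assumes "comm_ring_hom h"
  shows "comm_ring_hom (\<lambda>p. poly (map_poly h p) u)"
proof -
  interpret map_poly_comm_ring_hom h
    by (intro map_poly_comm_ring_hom.intro assms)
  show ?thesis
    by unfold_locales (simp_all add: hom_distribs)
qed

lemma hom_poly_map_poly:
  assumes "comm_ring_hom \<phi>" and "comm_ring_hom h"
  shows "\<phi> (poly (map_poly h p) u) = poly (map_poly (\<lambda>c. \<phi> (h c)) p) (\<phi> u)"
proof -
  interpret \<phi>: comm_ring_hom \<phi> by fact
  interpret h: comm_ring_hom h by fact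
  show ?thesis
    by (induction p) (simp_all add: map_poly_pCons \<phi>.hom_add \<phi>.hom_mult)
qed

lemma comm_ring_hom_subst3:
  assumes "comm_ring_hom h"
  shows "comm_ring_hom (\<lambda>F. subst3 h F u v w)"
  unfolding subst3_def by (intro comm_ring_hom_poly_map_poly assms)

lemma hom_subst3:
  assumes "comm_ring_hom \<phi>" and "comm_ring_hom h"
  shows "\<phi> (subst3 h F u v w) = subst3 (\<lambda>c. \<phi> (h c)) F (\<phi> u) (\<phi> v) (\<phi> w)"
  unfolding subst3_def
  using assms by (simp add: hom_poly_map_poly comm_ring_hom_poly_map_poly)

lemma poly_map_poly_as_sum:
  fixes h :: "'a::comm_ring_1 \<Rightarrow> 'b::comm_ring_1"
  assumes "h 0 = 0"
  shows "poly (map_poly h p) u = (\<Sum>i\<le>degree p. h (coeff p i) * u ^ i)"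
  using eval_poly_as_sum[of h p u] assms by (simp add: eval_poly_def mult.commute)

definition terms3 :: "'a::comm_ring_1 poly3 \<Rightarrow> (nat \<times> nat \<times> nat) set" where
  "terms3 F = {(i, j, l). coeff3 F i j l \<noteq> 0}"

lemma finite_terms3: "finite (terms3 F)"
proof -
  let ?B = "SIGMA l:{..degree F}. SIGMA j:{..degree (coeff F l)}. {..degree (coeff (coeff F l) j)}"
  have "terms3 F \<subseteq> (\<lambda>(l, j, i). (i, j, l)) ` ?B"
  proof
    fix t assume "t \<in> terms3 F"
    then obtain i j l where t: "t = (i, j, l)" "coeff (coeff (coeff F l) j) i \<noteq> 0"
      by (auto simp: terms3_def coeff3_def)
    then have "i \<le> degree (coeff (coeff F l) j)" "j \<le> degree (coeff F l)" "l \<le> degree F"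
      by (auto intro!: le_degree)
    then show "t \<in> (\<lambda>(l, j, i). (i, j, l)) ` ?B"
      unfolding t(1) by (intro image_eqI[of _ _ "(l, j, i)"]) auto
  qed
  then show ?thesis
    by (rule finite_subset) (intro finite_imageI finite_SigmaI finite_atMost)
qed

text \<open>
  The nested evaluation of an iterated polynomial becomes a single sum over the monomials that occur.
  Most facts on substitution below are read off termwise.
\<close>

lemma subst3_as_sum:
  assumes "comm_ring_hom h"
  shows "subst3 h F u v w = (\<Sum>(i, j, l)\<in>terms3 F. h (coeff3 F i j l) * u ^ i * v ^ j * w ^ l)"
proof -
  interpret h: comm_ring_hom h by fact
  let ?B = "SIGMA l:{..degree F}. SIGMA j:{..degree (coeff F l)}. {..degree (coeff (coeff F l) j)}"
  let ?t = "\<lambda>i j l. h (coeff3 F i j l) * u ^ i * v ^ j * w ^ l"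
  have h2: "(\<lambda>p. poly (map_poly h p) u) 0 = 0" "(\<lambda>q. poly (map_poly (\<lambda>p. poly (map_poly h p) u) q) v) 0 = 0"
    by simp_all
  have "subst3 h F u v w = (\<Sum>l\<le>degree F. \<Sum>j\<le>degree (coeff F l). \<Sum>i\<le>degree (coeff (coeff F l) j). ?t i j l)"
    unfolding subst3_def poly_map_poly_as_sum[where h = "\<lambda>q. poly (map_poly (\<lambda>p. poly (map_poly h p) u) q) v", OF h2(2)]
    unfolding poly_map_poly_as_sum[where h = "\<lambda>p. poly (map_poly h p) u", OF h2(1)]
    unfolding poly_map_poly_as_sum[of h, OF h.hom_zero]
    by (simp add: coeff3_def sum_distrib_right)
  also have "\<dots> = (\<Sum>(l, j, i)\<in>?B. ?t i j l)"
    by (simp add: sum.Sigma)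
  also have "\<dots> = (\<Sum>(i, j, l)\<in>terms3 F. ?t i j l)"
  proof (rule sum.reindex_bij_witness_not_neutral[of "{(l, j, i). coeff3 F i j l = 0} \<inter> ?B" "{}" _
        "\<lambda>(i, j, l). (l, j, i)" "\<lambda>(l, j, i). (i, j, l)"])
    show "finite ({(l, j, i). coeff3 F i j l = 0} \<inter> ?B)"
      by (intro finite_Int disjI2 finite_SigmaI finite_atMost)
  next
    fix t assume t: "t \<in> terms3 F - {}"
    then obtain i j l where ijl: "t = (i, j, l)" "coeff (coeff (coeff F l) j) i \<noteq> 0"
      by (auto simp: terms3_def coeff3_def)
    then have "i \<le> degree (coeff (coeff F l) j)" "j \<le> degree (coeff F l)" "l \<le> degree F"
      by (auto intro!: le_degree)
    then show "(\<lambda>(i, j, l). (l, j, i)) t \<in> ?B - ({(l, j, i). coeff3 F i j l = 0} \<inter> ?B)"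
      using ijl by (auto simp: coeff3_def)
  qed (auto simp: terms3_def)
  finally show ?thesis .
qed

lemma const3_hom: "comm_ring_hom (const3 :: 'a::comm_ring_1 \<Rightarrow> _)"
  by unfold_locales (simp_all add: pCons_one)

lemma monomial3:
  fixes c :: "'a::comm_ring_1"
  shows "const3 c * varx ^ i * vary ^ j * varz ^ l = monom (monom (monom c i) j) l"
proof -
  have "varx ^ i = [:[:monom (1::'a) i:]:]" "vary ^ j = [:monom (1::'a poly) j:]" "varz ^ l = monom (1::'a poly poly) l"
    by (simp_all add: monom_altdef poly_const_pow)
  then show ?thesis
    by (simp only:) (simp add: smult_monom)
qed

lemma coeff3_monomial3:
  "coeff3 (const3 c * varx ^ i * vary ^ j * varz ^ l) i' j' l' = (if i' = i \<and> j' = j \<and> l' = l then c else 0)"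
  unfolding monomial3 coeff3_def by simp

lemma coeff3_0: "coeff3 0 i j l = 0"
  by (simp add: coeff3_def)

lemma coeff3_sum: "coeff3 (\<Sum>t\<in>A. f t) i j l = (\<Sum>t\<in>A. coeff3 (f t) i j l)"
  by (simp add: coeff3_def coeff_sum)

lemma coeff3_eqI: "(\<And>i j l. coeff3 F i j l = coeff3 G i j l) \<Longrightarrow> F = G"
  by (intro poly_eqI) (simp add: coeff3_def)

lemma exists_coeff3: "F \<noteq> 0 \<Longrightarrow> \<exists>i j l. coeff3 F i j l \<noteq> 0"
  using coeff3_eqI[of F 0] by (auto simp: coeff3_0)

lemma subst3_variables: "subst3 const3 F varx vary varz = F"
proof (rule coeff3_eqI)
  fix i j l
  have "coeff3 (subst3 const3 F varx vary varz) i j l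
      = (\<Sum>t\<in>terms3 F. if t = (i, j, l) then coeff3 F i j l else 0)"
    unfolding subst3_as_sum[OF const3_hom] coeff3_sum
    by (intro sum.cong) (auto simp only: coeff3_monomial3 split: prod.splits if_splits)
  also have "\<dots> = coeff3 F i j l"
    using finite_terms3[of F] by (auto simp: terms3_def)
  finally show "coeff3 (subst3 const3 F varx vary varz) i j l = coeff3 F i j l" .
qed

lemma subst3_monomial:
  assumes "comm_ring_hom h"
  shows "subst3 h (const3 c * varx ^ i * vary ^ j * varz ^ l) u v w = h c * u ^ i * v ^ j * w ^ l"
proof (cases "c = 0")
  case True
  interpret h: comm_ring_hom h by fact
  have "terms3 (const3 c * varx ^ i * vary ^ j * varz ^ l) = {}"
    unfolding terms3_def coeff3_monomial3 using True by auto
  then show ?thesis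
    unfolding subst3_as_sum[OF assms] using True by simp
next
  case False
  have "terms3 (const3 c * varx ^ i * vary ^ j * varz ^ l) = {(i, j, l)}"
    unfolding terms3_def coeff3_monomial3 using False by auto
  then show ?thesis
    unfolding subst3_as_sum[OF assms] by (simp only: sum.insert finite.emptyI empty_iff sum.empty
        prod.case coeff3_monomial3 not_False_eq_True) simp
qed

lemma subst3_basic:
  assumes "comm_ring_hom h"
  shows "subst3 h (const3 c) u v w = h c" and "subst3 h varx u v w = u"
    and "subst3 h vary u v w = v" and "subst3 h varz u v w = w"
proof -
  interpret h: comm_ring_hom h by fact
  note m = subst3_monomial[OF assms]
  show "subst3 h (const3 c) u v w = h c"
    using m[of c 0 0 0 u v w] by simp
  have one: "const3 1 = (1 :: 'a poly3)"
    by (simp add: pCons_one)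
  show "subst3 h varx u v w = u" "subst3 h vary u v w = v" "subst3 h varz u v w = w"
    using m[of 1 1 0 0 u v w] m[of 1 0 1 0 u v w] m[of 1 0 0 1 u v w]
    unfolding one by (simp_all only: power_0 power_one_right mult_1 mult_1_right h.hom_one)
qed

section \<open>Homogeneity and orders of vanishing\<close>

lemma coeff3_mult_nonzeroE:
  assumes "coeff3 (F * G) i j l \<noteq> 0"
  obtains i1 j1 l1 i2 j2 l2 where "i = i1 + i2" "j = j1 + j2" "l = l1 + l2"
    "coeff3 F i1 j1 l1 \<noteq> 0" "coeff3 G i2 j2 l2 \<noteq> 0"
proof -
  from assms have "(\<Sum>l1\<le>l. \<Sum>j1\<le>j. \<Sum>i1\<le>i. coeff3 F i1 j1 l1 * coeff3 G (i - i1) (j - j1) (l - l1)) \<noteq> 0"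
    by (simp add: coeff3_def coeff_mult coeff_sum)
  then obtain l1 where l1: "l1 \<le> l"
    "(\<Sum>j1\<le>j. \<Sum>i1\<le>i. coeff3 F i1 j1 l1 * coeff3 G (i - i1) (j - j1) (l - l1)) \<noteq> 0"
    by (metis (mono_tags, lifting) sum.not_neutral_contains_not_neutral atMost_iff)
  then obtain j1 where j1: "j1 \<le> j"
    "(\<Sum>i1\<le>i. coeff3 F i1 j1 l1 * coeff3 G (i - i1) (j - j1) (l - l1)) \<noteq> 0"
    by (metis (mono_tags, lifting) sum.not_neutral_contains_not_neutral atMost_iff)
  then obtain i1 where i1: "i1 \<le> i" "coeff3 F i1 j1 l1 * coeff3 G (i - i1) (j - j1) (l - l1) \<noteq> 0"
    by (metis (mono_tags, lifting) sum.not_neutral_contains_not_neutral atMost_iff)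
  then have "coeff3 F i1 j1 l1 \<noteq> 0" "coeff3 G (i - i1) (j - j1) (l - l1) \<noteq> 0"
    by auto
  then show thesis
    using l1(1) j1(1) i1(1) by (intro that[of i1 "i - i1" j1 "j - j1" l1 "l - l1"]) auto
qed

lemma multiplicative_grading_homogeneous:
  "multiplicative_grading (\<lambda>n. {F :: 'a::comm_ring_1 poly3. homogeneous n F})"
proof
  fix F G :: "'a poly3" and m n
  assume *: "F \<in> {F. homogeneous m F}" "G \<in> {F. homogeneous n F}"
  show "F * G \<in> {F. homogeneous (m + n) F}"
    unfolding mem_Collect_eq homogeneous_def
  proof (intro allI impI)
    fix i j l assume "coeff3 (F * G) i j l \<noteq> 0"
    then show "i + j + l = m + n"
    proof (rule coeff3_mult_nonzeroE)
      fix i1 j1 l1 i2 j2 l2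
      assume s: "i = i1 + i2" "j = j1 + j2" "l = l1 + l2"
        and "coeff3 F i1 j1 l1 \<noteq> 0" "coeff3 G i2 j2 l2 \<noteq> 0"
      then have "i1 + j1 + l1 = m" "i2 + j2 + l2 = n"
        using * by (auto simp: homogeneous_def)
      then show ?thesis
        using s by simp
    qed
  qed
next
  fix F G :: "'a poly3" and n
  assume *: "F \<in> {F. homogeneous n F}" "G \<in> {F. homogeneous n F}"
  have "coeff3 F i j l \<noteq> 0 \<or> coeff3 G i j l \<noteq> 0" if "coeff3 (F + G) i j l \<noteq> 0" for i j l
    using that by (auto simp: coeff3_def)
  then show "F + G \<in> {F. homogeneous n F}"
    using * unfolding homogeneous_def mem_Collect_eq by blast
qed (auto simp: homogeneous_def coeff3_def split: if_splits)

text \<open>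
  The order of vanishing along $x = z = 0$, that is, at the point $[0:1:0]$. Points at infinity
  are moved there by a linear change of $x$ and $y$.
\<close>

definition transversal_order_ge :: "nat \<Rightarrow> 'a::comm_ring_1 poly3 \<Rightarrow> bool" where
  "transversal_order_ge n F \<longleftrightarrow> (\<forall>i j l. coeff3 F i j l \<noteq> 0 \<longrightarrow> n \<le> i + l)"

definition transversal_order :: "'a::comm_ring_1 poly3 \<Rightarrow> nat" where
  "transversal_order H = (LEAST n. \<exists>i j l. i + l = n \<and> coeff3 H i j l \<noteq> 0)"

lemma transversal_order_ge_self: "transversal_order_ge (transversal_order H) H"
  unfolding transversal_order_ge_def transversal_order_def by (auto intro!: Least_le)

lemma transversal_order_attained:
  assumes "H \<noteq> 0"
  obtains i j l where "i + l = transversal_order H" and "coeff3 H i j l \<noteq> 0"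
proof -
  obtain i j l where "coeff3 H i j l \<noteq> 0"
    using exists_coeff3[OF assms] by blast
  then have "\<exists>i' j l'. i' + l' = i + l \<and> coeff3 H i' j l' \<noteq> 0"
    by blast
  then have "\<exists>i j l. i + l = transversal_order H \<and> coeff3 H i j l \<noteq> 0"
    unfolding transversal_order_def by (rule LeastI)
  then show thesis
    using that by blast
qed

lemma multiplicative_grading_transversal:
  "multiplicative_grading (\<lambda>n. {F :: 'a::comm_ring_1 poly3. transversal_order_ge n F})"
proof
  fix F G :: "'a poly3" and m n
  assume *: "F \<in> {F. transversal_order_ge m F}" "G \<in> {F. transversal_order_ge n F}"
  show "F * G \<in> {F. transversal_order_ge (m + n) F}"
    unfolding mem_Collect_eq transversal_order_ge_def
  proof (intro allI impI)
    fix i j l assume "coeff3 (F * G) i j l \<noteq> 0"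
    then show "m + n \<le> i + l"
    proof (rule coeff3_mult_nonzeroE)
      fix i1 j1 l1 i2 j2 l2
      assume s: "i = i1 + i2" "l = l1 + l2"
        and "coeff3 F i1 j1 l1 \<noteq> 0" "coeff3 G i2 j2 l2 \<noteq> 0"
      then have "m \<le> i1 + l1" "n \<le> i2 + l2"
        using * by (auto simp: transversal_order_ge_def)
      then show ?thesis
        using s by simp
    qed
  qed
next
  fix F G :: "'a poly3" and n
  assume *: "F \<in> {F. transversal_order_ge n F}" "G \<in> {F. transversal_order_ge n F}"
  have "coeff3 F i j l \<noteq> 0 \<or> coeff3 G i j l \<noteq> 0" if "coeff3 (F + G) i j l \<noteq> 0" for i j l
    using that by (auto simp: coeff3_def)
  then show "F + G \<in> {F. transversal_order_ge n F}"
    using * unfolding transversal_order_ge_def mem_Collect_eq by blast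
qed (auto simp: transversal_order_ge_def coeff3_def split: if_splits)

text \<open>
  A local equation arises by setting one variable of a form to $1$. Distinct monomials of a form stay
  distinct, because the lost exponent is determined by the degree; this is the hypothesis of injectivity. So no
  cancellation occurs, and the order is the minimum of the remaining total exponents.
\<close>

lemma order_at_origin_monomial_subst:
  assumes mono: "\<And>i j l. u ^ i * v ^ j * w ^ l = varx ^ a i j l * vary ^ b i j l * varz ^ c i j l"
    and inj: "inj_on (\<lambda>(i, j, l). (a i j l, b i j l, c i j l)) (terms3 F)"
  shows "order_at_origin (subst3 const3 F u v w)
    = (LEAST n. \<exists>i j l. a i j l + b i j l + c i j l = n \<and> coeff3 F i j l \<noteq> 0)"
proof -
  let ?L = "subst3 const3 F u v w"
  let ?E = "\<lambda>(i, j, l). (a i j l, b i j l, c i j l)"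
  have L: "coeff3 ?L i' j' l' = (\<Sum>t\<in>terms3 F. case t of (i, j, l) \<Rightarrow>
      if ?E (i, j, l) = (i', j', l') then coeff3 F i j l else 0)" for i' j' l'
  proof -
    have "const3 x * u ^ i * v ^ j * w ^ l
        = const3 x * varx ^ a i j l * vary ^ b i j l * varz ^ c i j l" for x i j l
      using mono[of i j l] by (simp only: mult.assoc)
    then show ?thesis
      unfolding subst3_as_sum[OF const3_hom] coeff3_sum
      by (intro sum.cong refl, clarify) (simp only: coeff3_monomial3 prod.case prod.inject, auto)
  qed
  have eq: "coeff3 ?L (a i j l) (b i j l) (c i j l) = coeff3 F i j l" if "(i, j, l) \<in> terms3 F" for i j l
  proof -
    have "coeff3 ?L (a i j l) (b i j l) (c i j l)
        = (\<Sum>t\<in>terms3 F. if t = (i, j, l) then coeff3 F i j l else 0)"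
      unfolding L
    proof (intro sum.cong refl)
      fix t assume t: "t \<in> terms3 F"
      obtain i' j' l' where ijl: "t = (i', j', l')"
        by (cases t)
      show "(case t of (i', j', l') \<Rightarrow>
          if ?E (i', j', l') = (a i j l, b i j l, c i j l) then coeff3 F i' j' l' else 0)
        = (if t = (i, j, l) then coeff3 F i j l else 0)"
        using inj_onD[OF inj _ t that] by (auto simp: ijl)
    qed
    then show ?thesis
      using that finite_terms3[of F] by simp
  qed
  have "(\<exists>i' j' l'. i' + j' + l' = n \<and> coeff3 ?L i' j' l' \<noteq> 0)
      \<longleftrightarrow> (\<exists>i j l. a i j l + b i j l + c i j l = n \<and> coeff3 F i j l \<noteq> 0)" for n
  proof
    assume "\<exists>i' j' l'. i' + j' + l' = n \<and> coeff3 ?L i' j' l' \<noteq> 0"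
    then obtain i' j' l' where n: "i' + j' + l' = n" and ne: "coeff3 ?L i' j' l' \<noteq> 0" by blast
    from ne obtain i j l where "(i, j, l) \<in> terms3 F" "?E (i, j, l) = (i', j', l')"
      unfolding L by (auto elim!: sum.not_neutral_contains_not_neutral split: if_splits)
    then show "\<exists>i j l. a i j l + b i j l + c i j l = n \<and> coeff3 F i j l \<noteq> 0"
      using n by (auto simp: terms3_def)
  next
    assume "\<exists>i j l. a i j l + b i j l + c i j l = n \<and> coeff3 F i j l \<noteq> 0"
    then show "\<exists>i' j' l'. i' + j' + l' = n \<and> coeff3 ?L i' j' l' \<noteq> 0"
      using eq by (fastforce simp: terms3_def)
  qed
  then show ?thesis
    by (simp add: order_at_origin_def)
qed

lemma homogeneous_const3: "homogeneous 0 (const3 c)"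
  by (auto simp: homogeneous_def coeff3_def coeff_pCons split: nat.splits if_splits)

lemma power_z: "varz ^ k = (monom 1 k :: 'a::comm_ring_1 poly3)"
  by (simp add: monom_altdef)

lemma homogeneous_power_z: "homogeneous k (varz ^ k)"
  unfolding power_z by (auto simp: homogeneous_def coeff3_def split: if_splits)

lemma homogeneous_linear: "homogeneous 1 [:[:[:0, 1:], [:b:]:]:]"
  by (auto simp: homogeneous_def coeff3_def coeff_pCons split: nat.splits)

lemma homogeneous_varx: "homogeneous 1 varx" and homogeneous_vary: "homogeneous 1 vary"
  by (auto simp: homogeneous_def coeff3_def coeff_pCons split: nat.splits)

lemma homogeneous_varz: "homogeneous 1 varz"
  using homogeneous_power_z[of 1] by (simp only: power_one_right)

lemma homogeneous_terms3: "homogeneous d H \<Longrightarrow> (i, j, l) \<in> terms3 H \<Longrightarrow> i + j + l = d"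
  by (simp add: homogeneous_def terms3_def)

lemma homogeneous_subst3:
  fixes F :: "'a::comm_ring_1 poly3"
  assumes F: "homogeneous d F" and uvw: "homogeneous 1 u" "homogeneous 1 v" "homogeneous 1 w"
  shows "homogeneous d (subst3 const3 F u v w)"
proof -
  interpret multiplicative_grading "\<lambda>n. {F :: 'a poly3. homogeneous n F}"
    by (rule multiplicative_grading_homogeneous)
  have pow: "homogeneous n (p ^ n)" if "homogeneous 1 p" for p :: "'a poly3" and n
    by (induction n) (use that one mult[of p 1] in auto)
  have "(\<Sum>(i, j, l)\<in>terms3 F. const3 (coeff3 F i j l) * u ^ i * v ^ j * w ^ l) \<in> {F. homogeneous d F}"
  proof (intro sum, clarify)
    fix i j l assume "(i, j, l) \<in> terms3 F"
    then have d: "d = 0 + i + j + l"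
      using F by (simp add: terms3_def homogeneous_def)
    have "const3 (coeff3 F i j l) * u ^ i * v ^ j * w ^ l \<in> {F. homogeneous (0 + i + j + l) F}"
      by (intro mult) (simp_all add: homogeneous_const3 pow[OF uvw(1)] pow[OF uvw(2)] pow[OF uvw(3)])
    then show "homogeneous d (const3 (coeff3 F i j l) * u ^ i * v ^ j * w ^ l)"
      unfolding d by simp
  qed
  then show ?thesis
    by (simp add: subst3_as_sum[OF const3_hom])
qed

section \<open>Substitutions for the first two variables\<close>

text \<open>
  A linear change of $x$ and $y$ that fixes $z$ acts coefficientwise on polynomials in $z$, and therefore
  respects the decomposition $F = \sum_l F_l z^l$.
\<close>

definition subst2 :: "'a::comm_ring_1 poly poly \<Rightarrow> 'a poly poly \<Rightarrow> 'a poly poly \<Rightarrow> 'a poly poly" where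
  "subst2 u v q = poly (map_poly (\<lambda>p. poly (map_poly (\<lambda>c. [:[:c:]:]) p) u) q) v"

lemma const2_hom: "comm_ring_hom (\<lambda>c::'a::comm_ring_1. [:[:c:]:])"
  by unfold_locales (simp_all add: pCons_one)

lemma subst2_hom: "comm_ring_hom (subst2 u v)"
  unfolding subst2_def by (intro comm_ring_hom_poly_map_poly const2_hom)

lemma poly_map_poly_const_hom:
  assumes "comm_ring_hom h"
  shows "poly (map_poly (\<lambda>c. [:h c:]) p) [:0, 1:] = map_poly h p"
proof -
  interpret h: comm_ring_hom h by fact
  show ?thesis
    by (induction p) (simp_all add: map_poly_pCons)
qed

text \<open>
  Relates the coefficientwise action to the substitution in terms of which local equations are defined.
\<close>

lemma map_poly_subst2_eq_subst3: "map_poly (subst2 u v) F = subst3 const3 F [:u:] [:v:] varz"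
proof -
  have 1: "[:poly (map_poly (\<lambda>c. [:[:c:]:]) p) u:] = poly (map_poly const3 p) [:u:]" for p :: "'a poly"
    using hom_poly_map_poly[OF coeff_lift_hom.comm_ring_hom_axioms const2_hom, of p u] .
  have "[:subst2 u v q:] = poly (map_poly (\<lambda>p. poly (map_poly const3 p) [:u:]) q) [:v:]" for q
    unfolding subst2_def
    using hom_poly_map_poly[OF coeff_lift_hom.comm_ring_hom_axioms comm_ring_hom_poly_map_poly[OF const2_hom], of u q v] by (simp only: 1)
  then have "subst3 const3 F [:u:] [:v:] varz = poly (map_poly (\<lambda>q. [:subst2 u v q:]) F) varz"
    by (simp add: subst3_def)
  then show ?thesis
    by (simp add: poly_map_poly_const_hom[OF subst2_hom])
qed

lemma subst2_0: "subst2 u v 0 = 0"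
  by (simp add: subst2_def)

lemma subst2_pCons:
  "subst2 u v (pCons p q) = poly (map_poly (\<lambda>c. [:[:c:]:]) p) u + v * subst2 u v q"
proof -
  interpret h: comm_ring_hom "\<lambda>p. poly (map_poly (\<lambda>c. [:[:c:]:]) p) u"
    by (intro comm_ring_hom_poly_map_poly const2_hom)
  show ?thesis
    unfolding subst2_def h.map_poly_pCons_hom by simp
qed

lemma subst2_const: "subst2 u v [:[:c:]:] = [:[:c:]:]"
proof -
  interpret c2: comm_ring_hom "\<lambda>c::'a. [:[:c:]:]"
    by (rule const2_hom)
  show ?thesis
    unfolding subst2_pCons subst2_0 c2.map_poly_pCons_hom by simp
qed

lemma subst2_subst2:
  "subst2 u v (subst2 u' v' q) = subst2 (subst2 u v u') (subst2 u v v') q"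
proof -
  have c: "subst2 u v [:[:c:]:] = [:[:c:]:]" for c
    by (rule subst2_const)
  have 1: "subst2 u v (poly (map_poly (\<lambda>c. [:[:c:]:]) p) u') = poly (map_poly (\<lambda>c. [:[:c:]:]) p) (subst2 u v u')" for p
    using hom_poly_map_poly[OF subst2_hom const2_hom, of u v p u'] by (simp only: c)
  show ?thesis
    unfolding subst2_def[of u' v'] subst2_def[of "subst2 u v u'"]
    using hom_poly_map_poly[OF subst2_hom comm_ring_hom_poly_map_poly[OF const2_hom], of u v u' q v'] by (simp only: 1)
qed

lemma subst2_variables: "subst2 [:[:0, 1:]:] [:0, 1:] q = q"
proof -
  have "poly (map_poly (\<lambda>c. [:[:c:]:]) p) [:[:0, 1:]:] = [:p:]" for p :: "'a poly"
  proof -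
    have "[:poly (map_poly (\<lambda>c. [:c:]) p) [:0, 1:]:] = poly (map_poly (\<lambda>c. [:[:c:]:]) p) [:[:0, 1:]:]"
      using hom_poly_map_poly[OF coeff_lift_hom.comm_ring_hom_axioms coeff_lift_hom.comm_ring_hom_axioms, of p "[:0, 1:]"] .
    then show ?thesis
      using poly_map_poly_const_hom[of "\<lambda>c. c" p] by (simp add: comm_ring_hom_ident)
  qed
  then show ?thesis
    using poly_map_poly_const_hom[of "\<lambda>c. c" q] by (simp add: subst2_def comm_ring_hom_ident)
qed

lemma subst2_x: "subst2 u v [:[:0, 1:]:] = u"
proof -
  interpret c2: comm_ring_hom "\<lambda>c::'a. [:[:c:]:]"
    by (rule const2_hom)
  show ?thesis
    unfolding subst2_pCons subst2_0 c2.map_poly_pCons_hom by (simp add: pCons_one)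
qed

lemma subst2_y: "subst2 u v [:0, 1:] = v"
proof -
  have "subst2 u v [:0, 1:] = v * subst2 u v [:[:1:]:]"
    unfolding subst2_pCons[of u v 0] by (simp add: pCons_one)
  then show ?thesis
    unfolding subst2_const by (simp add: pCons_one)
qed

lemma map_poly_subst2_hom: "comm_ring_hom (map_poly (subst2 u v))"
proof -
  interpret map_poly_comm_ring_hom "subst2 u v"
    by (intro map_poly_comm_ring_hom.intro subst2_hom)
  show ?thesis ..
qed

lemma subst3_map_poly_subst2:
  assumes h: "comm_ring_hom h"
  shows "subst3 h (map_poly (subst2 u v) F) a b c
    = subst3 h F (subst3 h [:u:] a b c) (subst3 h [:v:] a b c) c"
  unfolding map_poly_subst2_eq_subst3 hom_subst3[OF comm_ring_hom_subst3[OF h] const3_hom] subst3_basic[OF h] ..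

section \<open>Divisors of forms\<close>

text \<open>
  Without this bound \<open>GREATEST\<close> in the definition of \<open>divisor_of\<close> would be meaningless. By unique
  factorisation \<open>n\<close> is at most the number of irreducible factors of \<open>F\<close>.
\<close>

lemma prime_power_dvd_bounded:
  fixes p F :: "'a::ufd"
  assumes p: "prime_elem p" and F: "F \<noteq> 0"
  shows "\<exists>N. \<forall>n. p ^ n dvd F \<longrightarrow> n \<le> N"
proof (cases "F dvd 1")
  case True
  have "n = 0" if "p ^ n dvd F" for n
  proof (rule ccontr)
    assume "n \<noteq> 0"
    then have "p dvd F"
      by (intro dvd_trans[OF dvd_power that]) simp
    then show False
      using True p unfolding prime_elem_def by (blast intro: dvd_trans)
  qed
  then show ?thesis by auto
next
  case False
  then obtain A where A: "mset_factors A F"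
    using mset_factors_exist F by blast
  have "n \<le> size A" if n: "p ^ n dvd F" for n
  proof (cases "n = 0")
    case False
    have "mset_factors (replicate_mset n p) (p ^ n)"
      using p False by (auto simp: prime_elem_imp_irreducible)
    then obtain A' where "A' \<subseteq># A" "rel_mset (ddvd) (replicate_mset n p) A'"
      using dvd_imp_subset_factors[OF n _ A] by blast
    then show ?thesis
      using rel_mset_size size_mset_mono by fastforce
  qed simp
  then show ?thesis by blast
qed

lemma divisor_of_decomp:
  assumes p: "prime_elem p" and F: "F \<noteq> 0"
  obtains n Q where "divisor_of F p = n" and "F = p ^ n * Q" and "\<not> p dvd Q"
proof -
  obtain N where N: "\<And>n. p ^ n dvd F \<Longrightarrow> n \<le> N"
    using prime_power_dvd_bounded[OF p F] by blast
  define n where "n = (GREATEST n. p ^ n dvd F)"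
  have "p ^ n dvd F"
    unfolding n_def by (rule GreatestI_nat[of _ 0 N]) (use N in auto)
  then obtain Q where Q: "F = p ^ n * Q"
    by (rule dvdE)
  have "\<not> p dvd Q"
  proof
    assume "p dvd Q"
    then obtain Q' where "Q = p * Q'"
      by (rule dvdE)
    then have "F = p ^ Suc n * Q'"
      unfolding Q by (simp add: mult_ac)
    then have "p ^ Suc n dvd F"
      by (rule dvdI)
    then have "Suc n \<le> n"
      unfolding n_def by (rule Greatest_le_nat) (use N in auto)
    then show False by simp
  qed
  moreover have "divisor_of F p = n"
    using p by (simp add: divisor_of_def n_def)
  ultimately show thesis
    using Q by (intro that)
qed

lemma divisor_of_ge:
  assumes p: "prime_elem p" and F: "F \<noteq> 0" and n: "p ^ n dvd F"
  shows "n \<le> divisor_of F p"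
proof -
  obtain N where "\<And>n. p ^ n dvd F \<Longrightarrow> n \<le> N"
    using prime_power_dvd_bounded[OF p F] by blast
  then show ?thesis
    using p n Greatest_le_nat[of "\<lambda>n. p ^ n dvd F" n N] by (simp add: divisor_of_def)
qed

lemma divisor_of_unique:
  assumes p: "prime_elem p" and F: "F = p ^ n * Q" and Q: "\<not> p dvd Q"
  shows "divisor_of F p = n"
proof -
  have p0: "p \<noteq> 0"
    using p by (auto simp: prime_elem_def)
  have "m \<le> n" if "p ^ m dvd p ^ n * Q" for m
  proof (rule ccontr)
    assume "\<not> m \<le> n"
    then have "p ^ n * p dvd p ^ n * Q"
      using dvd_trans[OF le_imp_power_dvd[of "Suc n" m p] that] by (simp add: mult.commute)
    then show False
      using p0 Q by simp
  qed
  then have "(GREATEST m. p ^ m dvd F) = n"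
    unfolding F by (intro Greatest_equality) auto
  then show ?thesis
    using p by (simp add: divisor_of_def)
qed

lemma divisor_of_mult:
  assumes "F \<noteq> 0" and "G \<noteq> 0"
  shows "divisor_of (F * G) p = divisor_of F p + divisor_of G p"
proof (cases "prime_elem p")
  case True
  obtain m Q where Q: "divisor_of F p = m" "F = p ^ m * Q" "\<not> p dvd Q"
    using divisor_of_decomp[OF True assms(1)] .
  obtain n Q' where Q': "divisor_of G p = n" "G = p ^ n * Q'" "\<not> p dvd Q'"
    using divisor_of_decomp[OF True assms(2)] .
  have "divisor_of (F * G) p = m + n"
  proof (rule divisor_of_unique[OF True])
    show "F * G = p ^ (m + n) * (Q * Q')"
      unfolding Q(2) Q'(2) by (simp add: power_add mult_ac)
    show "\<not> p dvd Q * Q'"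
      using Q(3) Q'(3) True by (simp add: prime_elem_dvd_mult_iff)
  qed
  then show ?thesis
    using Q(1) Q'(1) by simp
qed (simp add: divisor_of_def)

lemma divisor_of_uminus: "divisor_of (- F) = divisor_of F"
proof -
  have "q dvd - F \<longleftrightarrow> q dvd F" for q
    by (rule dvd_minus_iff)
  then show ?thesis
    unfolding divisor_of_def by presburger
qed

lemma divisor_of_unit:
  assumes "u dvd 1"
  shows "divisor_of u p = 0"
proof (cases "prime_elem p")
  case True
  then have "\<not> p dvd u"
    using assms unfolding prime_elem_def by (blast intro: dvd_trans)
  then show ?thesis
    by (intro divisor_of_unique[OF True, of u 0 u]) simp
qed (simp add: divisor_of_def)

text \<open>
  Induction on the number of irreducible factors of \<open>F\<close>: such a factor also divides \<open>G\<close> and can be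
  cancelled, since divisors are additive.
\<close>

lemma dvd_if_divisor_of_le:
  fixes F G :: "'a::field poly3"
  assumes "F \<noteq> 0" and "G \<noteq> 0" and "\<And>p. divisor_of F p \<le> divisor_of G p"
  shows "F dvd G"
proof (cases "F dvd 1")
  case False
  then obtain A where "mset_factors A F"
    using mset_factors_exist assms(1) by blast
  then have "prod_mset A = F" "\<forall>p\<in>#A. prime_elem p"
    by (auto simp: mset_factors_def)
  then show ?thesis
    using assms(2,3)
  proof (induction A arbitrary: F G)
    case (add p A)
    then have p: "prime_elem p" and p0: "p \<noteq> 0"
      by (auto simp: prime_elem_def)
    have A0: "prod_mset A \<noteq> 0"
      using add.prems(2) by auto
    have F: "F = p * prod_mset A"
      using add.prems(1) by simp
    have "p ^ 1 dvd F" "F \<noteq> 0"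
      using F p0 A0 by auto
    then have "1 \<le> divisor_of G p"
      using divisor_of_ge[OF p, of F 1] add.prems(4)[of p] by linarith
    moreover obtain n Q where Q: "divisor_of G p = n" "G = p ^ n * Q" "\<not> p dvd Q"
      using divisor_of_decomp[OF p add.prems(3)] .
    ultimately have "p dvd G"
      unfolding Q(2) by (intro dvd_mult2 dvd_power) simp
    then obtain G' where G: "G = p * G'"
      by (rule dvdE)
    then have G0: "G' \<noteq> 0"
      using add.prems(3) by auto
    have "divisor_of (prod_mset A) q \<le> divisor_of G' q" for q
      using add.prems(4)[of q] unfolding F G divisor_of_mult[OF p0 A0] divisor_of_mult[OF p0 G0] by simp
    then have "prod_mset A dvd G'"
      using add.IH[OF refl _ G0] add.prems(2) by simp
    then show ?case
      unfolding F G by simp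
  qed simp
qed (blast intro: dvd_trans one_dvd)

text \<open>
  The units of $k[x,y,z]$ are the nonzero constants.
\<close>

lemma eq_const_mult_if_divisor_of_eq:
  fixes F G :: "'a::field poly3"
  assumes "F \<noteq> 0" and "G \<noteq> 0" and "divisor_of F = divisor_of G"
  obtains c where "c \<noteq> 0" and "F = const3 c * G"
proof -
  have "F dvd G" "G dvd F"
    using assms by (auto intro!: dvd_if_divisor_of_le)
  then obtain u v where uv: "F = G * u" "G = F * v"
    by (blast elim: dvdE)
  have "G * (u * v) = G * 1"
    by (simp only: mult.assoc[symmetric] uv(1)[symmetric] uv(2)[symmetric] mult_1_right)
  then have "1 = u * v"
    using mult_left_cancel[OF assms(2), of "u * v" 1] by metis
  then have "u dvd 1"
    by (rule dvdI)
  then obtain u2 where u2: "u = [:u2:]" "u2 dvd 1"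
    unfolding is_unit_poly_iff by blast
  then obtain u1 where u1: "u2 = [:u1:]" "u1 dvd 1"
    unfolding is_unit_poly_iff by blast
  then obtain c where c: "u1 = [:c:]" "c dvd 1"
    unfolding is_unit_poly_iff by blast
  have "c \<noteq> 0"
    using c(2) by (metis dvd_0_left zero_neq_one)
  moreover have "F = const3 c * G"
    unfolding uv(1) u2(1) u1(1) c(1) by (rule mult.commute)
  ultimately show thesis
    by (rule that)
qed

lemma divisor_of_const_mult:
  fixes F :: "'a::field poly3"
  assumes "c \<noteq> 0"
  shows "divisor_of (const3 c * F) = divisor_of F"
proof (cases "F = 0")
  case False
  have "const3 c dvd 1"
    using assms by (simp add: is_unit_const_poly_iff dvd_field_iff)
  then have unit: "divisor_of (const3 c) p = 0" for p
    by (rule divisor_of_unit)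
  have "const3 c \<noteq> 0"
    using assms by simp
  then have "divisor_of (const3 c * F) p = divisor_of F p" for p
    unfolding divisor_of_mult[OF \<open>const3 c \<noteq> 0\<close> False] unit by simp
  then show ?thesis
    by (rule ext)
qed simp

lemma prime_elem_X: "prime_elem ([:0, 1:] :: 'a::idom poly)"
proof -
  have "[:0, 1:] dvd p \<longleftrightarrow> poly p 0 = 0" for p :: "'a poly"
    using dvd_iff_poly_eq_0[of 0 p] by simp
  then show ?thesis
    unfolding prime_elem_def by simp
qed

lemma prime_elem_varx: "prime_elem (varx :: 'a::field poly3)"
  by (intro lift_prime_elem_poly prime_elem_X)

text \<open>
  Shows that the line through $A$ and a point at infinity is a prime divisor: its equation is the image of
  $x$ under a linear change of coordinates.
\<close>

lemma prime_elem_automorphism: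
  assumes "comm_ring_hom \<phi>" and "comm_ring_hom \<psi>"
    and "\<And>r. \<phi> (\<psi> r) = r" and "\<And>r. \<psi> (\<phi> r) = r" and p: "prime_elem p"
  shows "prime_elem (\<phi> p)"
proof -
  interpret \<phi>: comm_ring_hom \<phi> by fact
  interpret \<psi>: comm_ring_hom \<psi> by fact
  have dvd: "\<phi> p dvd a \<longleftrightarrow> p dvd \<psi> a" for a
    using \<phi>.hom_dvd[of p "\<psi> a"] \<psi>.hom_dvd[of "\<phi> p" a] assms(3,4) by auto
  have "\<phi> p \<noteq> 0"
    using p assms(4)[of p] unfolding prime_elem_def by (metis \<psi>.hom_zero)
  then show ?thesis
    using p unfolding prime_elem_def dvd \<psi>.hom_mult \<psi>.hom_one by blast
qed

section \<open>The conchoidal form as a resultant\<close>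

text \<open>
  The polynomial $F(\lambda x, \lambda y, z)$ in $\lambda$: the form \<open>F\<close> along the line through
  $A = [0:0:1]$ and a generic point.
\<close>

definition ray :: "'a::comm_ring_1 poly3 \<Rightarrow> 'a poly3 poly" where
  "ray F = subst3 (\<lambda>c. [:const3 c:]) F ([:0, 1:] * [:varx:]) ([:0, 1:] * [:vary:]) [:varz:]"

lemma const4_hom: "comm_ring_hom (\<lambda>c::'a::comm_ring_1. [:const3 c:])"
  by unfold_locales (simp_all add: pCons_one)

lemma ray_hom: "comm_ring_hom ray"
  unfolding ray_def by (intro comm_ring_hom_subst3 const4_hom)

lemma poly_ray_1: "poly (ray F) 1 = F"
proof -
  have hom: "comm_ring_hom (\<lambda>p :: 'a poly3 poly. poly p 1)" by (rule poly_hom.comm_ring_hom_axioms)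
  show ?thesis
    unfolding ray_def hom_subst3[OF hom const4_hom] by (simp add: subst3_variables)
qed

text \<open>
  Dehomogenising at $\mu = 1$ commutes with substitution and turns $\mu - \lambda$ into $1 - \lambda$.
\<close>

lemma conchoidal_form_eq_resultant:
  "conchoidal_form d e F G = resultant_sub d e (ray F \<circ>\<^sub>p [:1, - 1:]) (ray G)"
proof -
  have hom: "comm_ring_hom (\<lambda>p :: 'a poly3 poly poly. poly p 1)" by (rule poly_hom.comm_ring_hom_axioms)
  have hom': "comm_ring_hom (\<lambda>p :: 'a poly3 poly. p \<circ>\<^sub>p [:1, - 1:])" by (rule pcompose_hom.comm_ring_hom_axioms)
  have const2: "comm_ring_hom (\<lambda>c :: 'a. const2 (const3 c))"
    by unfold_locales (simp_all add: pCons_one)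
  show ?thesis
    unfolding conchoidal_form_def binary_resultant_def resultant_sub_def ray_def
      hom_subst3[OF hom const2] hom_subst3[OF hom' const4_hom]
    by (simp add: pcompose_pCons)
qed

text \<open>
  The part $F_l(x,y) z^l$ has degree $d - l$ in $x$ and $y$.
\<close>

lemma coeff_ray:
  assumes F: "homogeneous d F"
  shows "coeff (ray F) k = (if k \<le> d then monom (coeff F (d - k)) (d - k) else 0)"
proof (rule coeff3_eqI)
  fix i j l
  have "coeff3 (coeff (ray F) k) i j l
      = (\<Sum>(i', j', l')\<in>terms3 F. if (i', j', l') = (i, j, l) \<and> i + j = k then coeff3 F i j l else 0)"
  proof -
    (* the exponent of lambda in a monomial is its degree in x and y *)
    have "coeff ([:const3 c:] * ([:0, 1:] * [:varx:]) ^ i' * ([:0, 1:] * [:vary:]) ^ j' * [:varz:] ^ l') k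
        = (if i' + j' = k then const3 c * varx ^ i' * vary ^ j' * varz ^ l' else 0)" for c :: 'a and i' j' l'
    proof -
      have "[:const3 c:] * ([:0, 1:] * [:varx:]) ^ i' * ([:0, 1:] * [:vary:]) ^ j' * [:varz:] ^ l'
          = [:0, 1:] ^ (i' + j') * [:const3 c * varx ^ i' * vary ^ j' * varz ^ l':]"
        unfolding power_mult_distrib poly_const_pow power_add
        by (simp only: mult_ac) (simp add: mult_ac)
      also have "\<dots> = monom (const3 c * varx ^ i' * vary ^ j' * varz ^ l') (i' + j')"
        by (simp only: monom_altdef mult.commute[of "[:0, 1:] ^ (i' + j')"]) simp
      finally show ?thesis
        by (simp only: coeff_monom)
    qed
    then show ?thesis
      unfolding ray_def subst3_as_sum[OF const4_hom] coeff_sum coeff3_sum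
      by (intro sum.cong refl, clarify)
        (simp only: prod.case if_distrib[of "\<lambda>p. coeff3 p i j l"] coeff3_monomial3 coeff3_0, auto)
  qed
  also have "\<dots> = (\<Sum>t\<in>terms3 F. if t = (i, j, l) then (if i + j = k then coeff3 F i j l else 0) else 0)"
    by (intro sum.cong) (auto split: prod.splits)
  also have "\<dots> = (if i + j = k then coeff3 F i j l else 0)"
    using finite_terms3[of F] by (auto simp: terms3_def)
  also have "\<dots> = coeff3 (if k \<le> d then monom (coeff F (d - k)) (d - k) else 0) i j l"
  proof (cases "coeff3 F i j l = 0")
    case False
    then have "i + j + l = d"
      using F by (auto simp: homogeneous_def)
    then show ?thesis
      by (auto simp: coeff3_def)
  qed (auto simp: coeff3_def)
  finally show "coeff3 (coeff (ray F) k) i j l = coeff3 (if k \<le> d then monom (coeff F (d - k)) (d - k) else 0) i j l" .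
qed

lemma degree_ray_le: "homogeneous d F \<Longrightarrow> degree (ray F) \<le> d"
  by (intro degree_le) (simp add: coeff_ray)

lemma degree_flip_le:
  fixes p :: "'a::comm_ring_1 poly"
  shows "degree p \<le> d \<Longrightarrow> degree (p \<circ>\<^sub>p [:1, - 1:]) \<le> d"
  using degree_pcompose_le[of p "[:1, - 1:]"] by simp

text \<open>
  The leading coefficient of \<open>ray F\<close> is $F(x,y,0)$; it is nonzero when the line at infinity is not a
  component.
\<close>

lemma flip_ray_full_degree:
  fixes F :: "'a::field poly3"
  assumes "homogeneous d F" and "coeff F 0 \<noteq> 0"
  shows "degree (ray F \<circ>\<^sub>p [:1, - 1:]) = d" and "ray F \<circ>\<^sub>p [:1, - 1:] \<noteq> 0"
proof -
  have "coeff (ray F) d \<noteq> 0"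
    using assms by (simp add: coeff_ray)
  moreover from this have "degree (ray F) = d"
    using degree_ray_le[OF assms(1)] le_degree le_antisym by blast
  ultimately show "degree (ray F \<circ>\<^sub>p [:1, - 1:]) = d" "ray F \<circ>\<^sub>p [:1, - 1:] \<noteq> 0"
    by (auto simp: degree_pcompose pcompose_eq_0_iff)
qed

lemma coeff_0_flip: "coeff (ray F \<circ>\<^sub>p [:1, - 1:]) 0 = F"
  by (simp add: poly_ray_1)

lemma ray_mult: "ray (F * G) = ray F * ray G"
proof -
  interpret comm_ring_hom "ray :: 'a poly3 \<Rightarrow> _" by (rule ray_hom)
  show ?thesis by (rule hom_mult)
qed

lemma ray_eq_0_iff: "ray F = 0 \<longleftrightarrow> F = 0"
proof -
  interpret comm_ring_hom "ray :: 'a poly3 \<Rightarrow> _" by (rule ray_hom)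
  show ?thesis using poly_ray_1[of F] by auto
qed

lemma conchoidal_form_mult:
  fixes F :: "'a::field poly3"
  assumes "homogeneous d F" and "coeff F 0 \<noteq> 0" and "homogeneous e G" and "homogeneous e' G'"
  shows "conchoidal_form d (e + e') F (G * G') = conchoidal_form d e F G * conchoidal_form d e' F G'"
  unfolding conchoidal_form_eq_resultant ray_mult
  using assms by (intro resultant_sub_mult flip_ray_full_degree degree_ray_le)

lemma ray_const: "ray (const3 c) = [:const3 c:]"
  by (rule poly_eqI) (auto simp: coeff_ray[OF homogeneous_const3] monom_0 coeff_pCons split: nat.splits)

lemma ray_power_z: "ray (varz ^ k) = [:varz ^ k:]"
  unfolding power_z
  by (rule poly_eqI)
    (auto simp: coeff_ray[OF homogeneous_power_z[unfolded power_z]] coeff_pCons split: nat.splits)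

lemma coeff_flip:
  fixes p :: "'a::comm_ring_1 poly"
  shows "coeff (p \<circ>\<^sub>p [:1, - 1:]) k = (\<Sum>m\<le>degree p. coeff p m * coeff ([:1, - 1:] ^ m) k)"
  by (simp add: pcompose_altdef poly_map_poly_as_sum coeff_sum)

lemma map_poly_flip:
  assumes "comm_ring_hom h"
  shows "map_poly h (p \<circ>\<^sub>p [:1, - 1:]) = map_poly h p \<circ>\<^sub>p [:1, - 1:]"
proof -
  interpret comm_ring_hom h by fact
  show ?thesis
    by (simp add: map_poly_pcompose map_poly_pCons_hom hom_uminus)
qed

text \<open>
  The coefficients of $(1-X)^m$ are integers and hence of degree $0$.
\<close>

lemma (in multiplicative_grading) coeff_flip_mem:
  assumes "\<And>m. coeff p m \<in> S a"
  shows "coeff (p \<circ>\<^sub>p [:1, - 1:]) k \<in> S a"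
proof -
  have flip: "coeff ([:1, - 1:] ^ m) k \<in> S 0" for m k
  proof (induction m arbitrary: k)
    case (Suc m)
    show ?case
      using Suc add[OF Suc minus[OF Suc]] by (cases k) auto
  qed (auto intro: zero one)
  have "coeff p m * coeff ([:1, - 1:] ^ m) k \<in> S (a + 0)" for m
    by (intro mult assms flip)
  then show ?thesis
    unfolding coeff_flip by (intro sum) simp
qed

lemma coeff3_monom_slice: "coeff3 (monom (coeff F l) l) i j l' = (if l' = l then coeff3 F i j l else 0)"
  by (simp add: coeff3_def)

text \<open>
  The Sylvester matrix has \<open>e\<close> rows of forms of degree \<open>d\<close> and \<open>d\<close> rows of forms of
  degree \<open>e\<close>.
\<close>

lemma homogeneous_conchoidal_form:
  fixes F G :: "'a::field poly3"
  assumes F: "homogeneous d F" and G: "homogeneous e G"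
  shows "homogeneous (2 * e * d) (conchoidal_form d e F G)"
proof -
  interpret multiplicative_grading "\<lambda>n. {F :: 'a poly3. homogeneous n F}"
    by (rule multiplicative_grading_homogeneous)
  have ray: "coeff (ray H) k \<in> {F. homogeneous n F}" if "homogeneous n H" for H :: "'a poly3" and n k
    unfolding coeff_ray[OF that] mem_Collect_eq homogeneous_def
  proof (intro allI impI)
    fix i j l assume "coeff3 (if k \<le> n then monom (coeff H (n - k)) (n - k) else 0) i j l \<noteq> 0"
    then have "coeff3 H i j l \<noteq> 0"
      by (auto simp: coeff3_monom_slice coeff3_0 split: if_splits)
    then show "i + j + l = n"
      using that unfolding homogeneous_def by blast
  qed
  have "conchoidal_form d e F G \<in> {H. homogeneous (e * d + d * e) H}"
    unfolding conchoidal_form_eq_resultant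
    by (intro resultant_sub_mem coeff_flip_mem ray F G)
  moreover have "e * d + d * e = 2 * e * d"
    by simp
  ultimately show ?thesis
    by (simp only: mem_Collect_eq)
qed

text \<open>
  At $z = 0$ the two polynomials in $\lambda$ become $F_0 (1-\lambda)^d$ and $G_0 \lambda^e$, whose resultant
  is a product of powers of $F_0$ and $G_0$ up to sign.
\<close>

lemma conchoidal_form_nonzero_if_coeff_0:
  fixes F G :: "'a::field poly3"
  assumes F: "homogeneous d F" "coeff F 0 \<noteq> 0" and G: "homogeneous e G" "coeff G 0 \<noteq> 0"
  shows "conchoidal_form d e F G \<noteq> 0"
proof -
  let ?r = "\<lambda>r :: 'a poly3. poly r 0"
  have hom: "comm_ring_hom ?r"
    by (rule poly_hom.comm_ring_hom_axioms)
  have ray0: "map_poly ?r (ray H) = monom (coeff H 0) n" if "homogeneous n H" for H :: "'a poly3" and n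
    by (rule poly_eqI) (use that in \<open>auto simp: coeff_map_poly coeff_ray poly_monom poly_0_coeff_0 zero_power\<close>)
  define f where "f = monom (coeff F 0) d \<circ>\<^sub>p [:1, - 1:]"
  have f: "f \<noteq> 0" "degree f = d" "coeff f 0 = coeff F 0"
    using F(2) by (auto simp: f_def degree_pcompose pcompose_eq_0_iff degree_monom_eq poly_monom)
  have "?r (conchoidal_form d e F G) = resultant_sub d e f (monom (coeff G 0) e)"
    unfolding conchoidal_form_eq_resultant resultant_sub_map_poly[OF hom] f_def poly_hom.map_poly_pcompose
      ray0[OF F(1)] ray0[OF G(1)]
    by (simp add: poly_hom.map_poly_pCons_hom)
  also have "\<dots> = resultant_sub d (0 + e) f ([:coeff G 0:] * [:0, 1:] ^ e)"
    by (simp add: monom_altdef)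
  also have "\<dots> = resultant_sub d 0 f [:coeff G 0:] * resultant_sub d e f ([:0, 1:] ^ e)"
    using f degree_power_le[of "[:0, 1::'a poly poly:]" e] by (intro resultant_sub_mult) auto
  also have "\<dots> \<noteq> 0"
    using resultant_sub_const[OF f(1,2), of 0 "coeff G 0"] resultant_sub_X_power[OF f(1,2), of e] f(3) F(2) G(2)
    by (auto simp: eq_up_to_sign_def)
  finally show ?thesis
    by auto
qed

lemma homogeneous_mult_z_pow:
  assumes "homogeneous e (monom 1 k * G)"
  shows "homogeneous (e - k) G"
  unfolding homogeneous_def
proof (intro allI impI)
  fix i j l assume "coeff3 G i j l \<noteq> 0"
  then have "coeff3 (monom 1 k * G) i j (l + k) \<noteq> 0"
    by (simp add: coeff3_def coeff_monom_mult)
  then have "i + j + (l + k) = e"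
    using assms unfolding homogeneous_def by blast
  then show "i + j + l = e - k"
    by simp
qed

text \<open>
  The line at infinity may be a component of \<open>G\<close>. Its multiple is split off; it contributes a resultant with a
  constant polynomial.
\<close>

lemma conchoidal_form_nonzero:
  fixes F G :: "'a::field poly3"
  assumes F: "homogeneous d F" "coeff F 0 \<noteq> 0" and G: "homogeneous e G" "G \<noteq> 0"
  shows "conchoidal_form d e F G \<noteq> 0"
proof -
  (* k is the multiplicity of the line at infinity in G *)
  obtain H where "G = varz ^ Polynomial.order 0 G * H" "\<not> varz dvd H"
    using order_decomp[OF G(2), of 0] by auto
  then obtain k where k: "G = varz ^ k * H" and H0: "coeff H 0 \<noteq> 0"
    by (auto simp: dvd_iff_poly_eq_0 poly_0_coeff_0)
  have homH: "homogeneous (e - k) H"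
    using G(1) k homogeneous_mult_z_pow[of e k H] by (simp add: monom_altdef)
  have "k \<le> e"
  proof -
    obtain i j l where "coeff3 H i j l \<noteq> 0"
      using H0 exists_coeff3[of H] by (metis coeff_0)
    then have "coeff3 G i j (l + k) \<noteq> 0"
      using k by (simp add: coeff3_def coeff_monom_mult monom_altdef[symmetric, of 1, simplified])
    then have "i + j + (l + k) = e"
      using G(1) unfolding homogeneous_def by blast
    then show ?thesis
      by simp
  qed
  then have "conchoidal_form d e F G = conchoidal_form d (k + (e - k)) F (varz ^ k * H)"
    using k by simp
  also have "\<dots> = conchoidal_form d k F (varz ^ k) * conchoidal_form d (e - k) F H"
    using F homH by (intro conchoidal_form_mult homogeneous_power_z)
  also have "\<dots> \<noteq> 0"
  proof -
    have "conchoidal_form d k F (varz ^ k) \<noteq> 0"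
      unfolding conchoidal_form_eq_resultant ray_power_z
        resultant_sub_const[OF flip_ray_full_degree(2,1)[OF F]]
      using flip_ray_full_degree(2)[OF F] by (simp only: mult_eq_0_iff power_eq_0_iff leading_coeff_0_iff) simp
    then show ?thesis
      using conchoidal_form_nonzero_if_coeff_0[OF F homH H0] by simp
  qed
  finally show ?thesis .
qed

text \<open>
  The flip $\lambda \mapsto 1 - \lambda$ is an involution and moves from one argument to the other.
\<close>

lemma conchoidal_form_swap:
  fixes F G :: "'a::field poly3"
  assumes F: "homogeneous d F" and G: "homogeneous e G"
  shows "eq_up_to_sign (conchoidal_form d e F G) (conchoidal_form e d G F)"
proof -
  let ?c = "\<lambda>p. p \<circ>\<^sub>p [:1, - 1::'a poly3:]"
  have flip2: "?c (?c p) = p" for p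
  proof -
    have "?c (?c p) = p \<circ>\<^sub>p (?c [:1, - 1:])"
      by (simp only: pcompose_assoc)
    also have "?c [:1, - 1:] = [:0, 1:]"
      by (simp add: pcompose_pCons)
    finally show ?thesis by simp
  qed
  have "eq_up_to_sign (conchoidal_form e d G F) (resultant_sub d e (ray F) (?c (ray G)))"
    unfolding conchoidal_form_eq_resultant
    using F G by (intro resultant_sub_swap degree_ray_le degree_flip_le)
  moreover have "eq_up_to_sign (resultant_sub d e (?c (ray F)) (?c (?c (ray G)))) (resultant_sub d e (ray F) (?c (ray G)))"
    using F G by (intro resultant_sub_flip degree_ray_le degree_flip_le)
  ultimately show ?thesis
    unfolding flip2 conchoidal_form_eq_resultant[of d e]
    using eq_up_to_sign_sym eq_up_to_sign_trans by blast
qed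

lemma conchoidal_const_mult:
  fixes F G :: "'a::field poly3"
  assumes F: "homogeneous d F" "coeff F 0 \<noteq> 0" and G: "homogeneous e G" and c: "c \<noteq> 0"
  shows "conchoidal d e F (const3 c * G) = conchoidal d e F G"
proof -
  have "conchoidal_form d (0 + e) F (const3 c * G) = conchoidal_form d 0 F (const3 c) * conchoidal_form d e F G"
    using F G homogeneous_const3 by (intro conchoidal_form_mult)
  also have "conchoidal_form d 0 F (const3 c) = const3 c ^ d"
    unfolding conchoidal_form_eq_resultant ray_const
      resultant_sub_const[OF flip_ray_full_degree(2,1)[OF F]] by simp
  also have "const3 c ^ d = const3 (c ^ d)"
    by (simp add: poly_const_pow)
  finally show ?thesis
    unfolding conchoidal_def using divisor_of_const_mult[of "c ^ d"] c by simp
qed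

text \<open>
  Equal divisors mean equal forms up to a scalar, in particular the degrees add up. The statement is then
  the multiplicativity of the resultant.
\<close>

lemma conchoidal_add:
  fixes F G\<^sub>1 G\<^sub>2 :: "'a::field poly3"
  assumes F: "homogeneous d F" "coeff F 0 \<noteq> 0"
    and G1: "curve e\<^sub>1 G\<^sub>1" and G2: "curve e\<^sub>2 G\<^sub>2" and G: "curve e G"
    and div: "divisor_of G = (\<lambda>p. divisor_of G\<^sub>1 p + divisor_of G\<^sub>2 p)"
  shows "conchoidal d e F G = (\<lambda>p. conchoidal d e\<^sub>1 F G\<^sub>1 p + conchoidal d e\<^sub>2 F G\<^sub>2 p)"
proof -
  interpret multiplicative_grading "\<lambda>n. {F :: 'a poly3. homogeneous n F}"
    by (rule multiplicative_grading_homogeneous)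
  have G1': "homogeneous e\<^sub>1 G\<^sub>1" "G\<^sub>1 \<noteq> 0" and G2': "homogeneous e\<^sub>2 G\<^sub>2" "G\<^sub>2 \<noteq> 0"
    and G': "homogeneous e G" "G \<noteq> 0"
    using G1 G2 G by (auto simp: curve_def)
  have "divisor_of G = divisor_of (G\<^sub>1 * G\<^sub>2)"
    unfolding div using divisor_of_mult[OF G1'(2) G2'(2)] by (intro ext) simp
  moreover have "G\<^sub>1 * G\<^sub>2 \<noteq> 0"
    using G1' G2' by simp
  ultimately obtain c where c: "c \<noteq> 0" and eq: "G = const3 c * (G\<^sub>1 * G\<^sub>2)"
    using eq_const_mult_if_divisor_of_eq[OF G'(2)] by metis
  have prod: "homogeneous (e\<^sub>1 + e\<^sub>2) (G\<^sub>1 * G\<^sub>2)"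
    using mult[of "G\<^sub>1" e\<^sub>1 "G\<^sub>2" e\<^sub>2] G1' G2' by simp
  (* a nonzero form has only one degree *)
  have "homogeneous (0 + (e\<^sub>1 + e\<^sub>2)) G"
    unfolding eq using mult[of "const3 c" 0 "G\<^sub>1 * G\<^sub>2" "e\<^sub>1 + e\<^sub>2"] prod homogeneous_const3 by blast
  then have e: "e = e\<^sub>1 + e\<^sub>2"
    using G' exists_coeff3[OF G'(2)] unfolding homogeneous_def by (metis add_0)
  have "conchoidal d e F G = conchoidal d (e\<^sub>1 + e\<^sub>2) F (G\<^sub>1 * G\<^sub>2)"
    unfolding eq e by (rule conchoidal_const_mult[OF F prod c])
  also have "\<dots> = (\<lambda>p. conchoidal d e\<^sub>1 F G\<^sub>1 p + conchoidal d e\<^sub>2 F G\<^sub>2 p)"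
    unfolding conchoidal_def conchoidal_form_mult[OF F G1'(1) G2'(1)]
    using divisor_of_mult[OF conchoidal_form_nonzero[OF F G1'] conchoidal_form_nonzero[OF F G2']]
    by (intro ext)
  finally show ?thesis .
qed

text \<open>
  The hypothesis says that $A$ has multiplicity at least \<open>\<nu>\<close> on \<open>G\<close>. The coefficient of $\lambda^k$ in
  \<open>ray G\<close> is the part of degree $k$ in $x$ and $y$, so $\lambda^\nu$ divides \<open>ray G\<close>.
  The resultant with $\lambda$ is, up to sign, the value at $\lambda = 0$ of the flipped \<open>ray F\<close>, which is
  \<open>F\<close>.
\<close>

lemma power_dvd_conchoidal_form:
  fixes F G :: "'a::field poly3"
  assumes F: "homogeneous d F" "coeff F 0 \<noteq> 0" and G: "homogeneous e G" "G \<noteq> 0"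
    and \<nu>: "\<And>i j l. coeff3 G i j l \<noteq> 0 \<Longrightarrow> \<nu> \<le> i + j"
  shows "F ^ \<nu> dvd conchoidal_form d e F G"
proof -
  let ?f = "ray F \<circ>\<^sub>p [:1, - 1:]"
  have low: "coeff (ray G) k = 0" if "k < \<nu>" for k
  proof (cases "k \<le> e")
    case True
    have "coeff3 G i j (e - k) = 0" for i j
    proof (rule ccontr)
      assume ne: "coeff3 G i j (e - k) \<noteq> 0"
      then have "i + j + (e - k) = e"
        using G(1) unfolding homogeneous_def by blast
      then show False
        using \<nu>[OF ne] True that by simp
    qed
    then have "coeff G (e - k) = 0"
      by (intro poly_eqI) (simp add: coeff3_def)
    then show ?thesis
      unfolding coeff_ray[OF G(1)] by simp
  qed (simp add: coeff_ray[OF G(1)])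
  then have "monom 1 \<nu> dvd ray G"
    by (simp add: monom_1_dvd_iff')
  then obtain g where "ray G = monom 1 \<nu> * g"
    by (rule dvdE)
  then have g: "ray G = [:0, 1:] ^ \<nu> * g"
    by (simp only: monom_altdef smult_1_left)
  have "g \<noteq> 0"
    using g G(2) ray_eq_0_iff[of G] by auto
  then have "degree (ray G) = \<nu> + degree g"
    unfolding g by (simp add: degree_mult_eq degree_power_eq)
  then have deg: "\<nu> + degree g \<le> e"
    using degree_ray_le[OF G(1)] by simp
  then have "conchoidal_form d e F G = resultant_sub d (\<nu> + (e - \<nu>)) ?f ([:0, 1:] ^ \<nu> * g)"
    unfolding conchoidal_form_eq_resultant g by simp
  also have "\<dots> = resultant_sub d \<nu> ?f ([:0, 1:] ^ \<nu>) * resultant_sub d (e - \<nu>) ?f g"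
    using deg flip_ray_full_degree[OF F] degree_power_le[of "[:0, 1::'a poly3:]" \<nu>]
    by (intro resultant_sub_mult) auto
  finally have eq: "conchoidal_form d e F G
      = resultant_sub d \<nu> ?f ([:0, 1:] ^ \<nu>) * resultant_sub d (e - \<nu>) ?f g" .
  have "eq_up_to_sign (resultant_sub d \<nu> ?f ([:0, 1:] ^ \<nu>)) (F ^ \<nu>)"
    using resultant_sub_X_power[OF flip_ray_full_degree(2,1)[OF F], of \<nu>] unfolding coeff_0_flip .
  then have "F ^ \<nu> dvd resultant_sub d \<nu> ?f ([:0, 1:] ^ \<nu>)"
    unfolding eq_up_to_sign_def by (elim disjE) (simp_all only: dvd_minus_iff dvd_refl)
  then show ?thesis
    unfolding eq by (rule dvd_mult2)
qed

lemma coeff3_ge_mult_at_A: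
  fixes G :: "'a::field poly3"
  assumes G: "homogeneous e G" and "coeff3 G i j l \<noteq> 0"
  shows "mult_at G pt_A \<le> i + j"
proof -
  have "inj_on (\<lambda>(i, j, l). (i, j, 0 :: nat)) (terms3 G)"
    by (intro inj_onI) (auto dest!: homogeneous_terms3[OF G])
  then have "mult_at G pt_A = (LEAST n. \<exists>i j l. i + j + 0 = n \<and> coeff3 G i j l \<noteq> 0)"
    using order_at_origin_monomial_subst[of varx vary 1 "\<lambda>i j l. i" "\<lambda>i j l. j" "\<lambda>i j l. 0" G]
    by (simp add: mult_at_def local_equation_def pt_A_def)
  then show ?thesis
    using assms(2) by (auto intro!: Least_le)
qed

section \<open>Points on the line at infinity\<close>

lemma order_at_origin_chart:
  fixes H :: "'a::field poly3"
  assumes H: "homogeneous d H" and X: "X = varx \<or> X = vary"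
  shows "order_at_origin (subst3 const3 H X 1 varz) = transversal_order H"
  using X
proof
  assume X: "X = varx"
  have "inj_on (\<lambda>(i, j, l). (i, 0 :: nat, l)) (terms3 H)"
    by (intro inj_onI) (auto dest!: homogeneous_terms3[OF H])
  then show ?thesis
    unfolding X transversal_order_def
    using order_at_origin_monomial_subst[of varx 1 varz "\<lambda>i j l. i" "\<lambda>i j l. 0" "\<lambda>i j l. l" H] by simp
next
  assume X: "X = vary"
  have "inj_on (\<lambda>(i, j, l). (0 :: nat, i, l)) (terms3 H)"
    by (intro inj_onI) (auto dest!: homogeneous_terms3[OF H])
  then show ?thesis
    unfolding X transversal_order_def
    using order_at_origin_monomial_subst[of vary 1 varz "\<lambda>i j l. 0" "\<lambda>i j l. i" "\<lambda>i j l. l" H] by simp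
qed

text \<open>
  The map given by \<open>u\<close>, \<open>v\<close> is inverse to the one given by \<open>u'\<close>, \<open>v'\<close>. The latter moves the point
  $[p:q:0]$ to $[0:1:0]$, and \<open>u\<close>, the image of $x$ under the former, is an equation of the line through $A$ and the
  point. For $q \neq 0$ a shear along $x$ suffices; otherwise $x$ and $y$ are exchanged. The two cases match
  the charts in the definition of \<open>local_equation\<close>.
\<close>

lemma coordinates_at_infinity:
  fixes p q :: "'a::field"
  assumes pq: "(p, q) \<noteq> (0, 0)"
  obtains u v u' v' c where
    "\<forall>r. subst2 u v (subst2 u' v' r) = r" "\<forall>r. subst2 u' v' (subst2 u v r) = r"
    "\<forall>d F. homogeneous d F \<longrightarrow> homogeneous d (map_poly (subst2 u' v') F)"
    "\<forall>d F. homogeneous d F \<longrightarrow> mult_at F (p, q, 0) = transversal_order (map_poly (subst2 u' v') F)"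
    "c \<noteq> 0" "line_through pt_A (p, q, 0) = const3 c * [:u:]"
proof (cases "q = 0")
  case False
  define shear where "shear = (\<lambda>r::'a. [:[:0, 1:], [:r:]:])"
  let ?y = "[:0, 1:] :: 'a poly poly"
  have shear_sum: "shear r = [:[:0, 1:]:] + [:[:r:]:] * ?y" for r
    by (simp add: shear_def)
  have shear_shear: "subst2 (shear r) ?y (shear (- r)) = [:[:0, 1:]:]" for r
  proof -
    interpret s: comm_ring_hom "subst2 (shear r) ?y" by (rule subst2_hom)
    show ?thesis
      unfolding shear_sum[of "- r"] s.hom_add s.hom_mult subst2_x subst2_y subst2_const
      by (simp add: shear_def)
  qed
  have inv: "subst2 (shear r) ?y (subst2 (shear (- r)) ?y s) = s" for r s
    unfolding subst2_subst2 shear_shear subst2_y by (rule subst2_variables)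
  define r where "r = p / q"
  have hom: "homogeneous d (map_poly (subst2 (shear r) ?y) F)" if "homogeneous d F" for d F
    unfolding map_poly_subst2_eq_subst3 shear_def
    by (intro homogeneous_subst3 that homogeneous_linear homogeneous_vary homogeneous_varz)
  have "subst3 const3 [:shear r:] varx 1 varz = const3 r + varx"
  proof -
    interpret s: comm_ring_hom "\<lambda>F::'a poly3. subst3 const3 F varx 1 varz"
      by (intro comm_ring_hom_subst3 const3_hom)
    have "[:shear r:] = varx + const3 r * vary"
      by (simp add: shear_def)
    then show ?thesis
      by (simp only: s.hom_add s.hom_mult subst3_basic[OF const3_hom]) simp
  qed
  then have "local_equation F (p, q, 0) = subst3 const3 (map_poly (subst2 (shear r) ?y) F) varx 1 varz" for F
    unfolding subst3_map_poly_subst2[OF const3_hom] subst3_basic(3)[OF const3_hom]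
    using False by (simp add: local_equation_def r_def)
  then have mult: "mult_at F (p, q, 0) = transversal_order (map_poly (subst2 (shear r) ?y) F)"
    if "homogeneous d F" for d F
    unfolding mult_at_def using order_at_origin_chart[OF hom[OF that]] by simp
  show thesis
  proof (rule that[of "shear (- r)" ?y "shear r" ?y "- q"])
    show "\<forall>s. subst2 (shear (- r)) ?y (subst2 (shear r) ?y s) = s"
      using inv[of "- r"] by simp
    show "line_through pt_A (p, q, 0) = const3 (- q) * [:shear (- r):]"
      using False by (simp add: line_through_def pt_A_def shear_def r_def)
  qed (use False inv hom mult in auto)
next
  case True
  then have p: "p \<noteq> 0"
    using pq by simp
  let ?x = "[:[:0, 1:]:] :: 'a poly poly" and ?y = "[:0, 1:] :: 'a poly poly"
  have inv: "subst2 ?y ?x (subst2 ?y ?x s) = s" for s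
    unfolding subst2_subst2 subst2_x subst2_y by (rule subst2_variables)
  have hom: "homogeneous d (map_poly (subst2 ?y ?x) F)" if "homogeneous d F" for d and F :: "'a poly3"
    unfolding map_poly_subst2_eq_subst3
    by (intro homogeneous_subst3 that homogeneous_varx homogeneous_vary homogeneous_varz)
  have "local_equation F (p, q, 0) = subst3 const3 (map_poly (subst2 ?y ?x) F) vary 1 varz" for F
    unfolding subst3_map_poly_subst2[OF const3_hom] subst3_basic(2,3)[OF const3_hom]
    using True by (simp add: local_equation_def)
  then have mult: "mult_at F (p, q, 0) = transversal_order (map_poly (subst2 ?y ?x) F)"
    if "homogeneous d F" for d F
    unfolding mult_at_def using order_at_origin_chart[OF hom[OF that]] by simp
  show thesis
  proof (rule that[of ?y ?x ?y ?x p])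
    show "line_through pt_A (p, q, 0) = const3 p * [:?y:]"
      using True by (simp add: line_through_def pt_A_def)
  qed (use p inv hom mult in auto)
qed

text \<open>
  Raising \<open>d\<close> or \<open>e\<close> by one adds \<open>\<eta> + \<epsilon>\<close> to both sides, which reduces the identity to the case
  \<open>d = \<eta>\<close> and \<open>e = \<epsilon>\<close>, where all minima are attained by the first argument.
\<close>

lemma sum_min_identity:
  fixes \<eta> \<epsilon> :: nat
  assumes "\<eta> \<le> d" and "\<epsilon> \<le> e"
  shows "(\<Sum>i<e. min (\<eta> + i) (\<eta> + \<epsilon>)) + (\<Sum>i<d. min (\<epsilon> + i) (\<eta> + \<epsilon>))
    = \<eta> * \<epsilon> + (\<Sum>i<d + e. min i (\<eta> + \<epsilon>))"
proof -
  obtain a b where ab: "d = \<eta> + a" "e = \<epsilon> + b"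
    using assms by (auto simp: le_iff_add)
  let ?N = "\<eta> + \<epsilon>"
  have base: "(\<Sum>i<\<epsilon>. min (\<eta> + i) ?N) + (\<Sum>i<\<eta>. min (\<epsilon> + i) ?N) = \<eta> * \<epsilon> + (\<Sum>i<\<eta> + \<epsilon>. min i ?N)"
  proof -
    have "(\<Sum>i<\<eta> + \<epsilon>. min i ?N) = (\<Sum>i<\<eta> + \<epsilon>. i)"
      by (intro sum.cong) auto
    also have "\<dots> = (\<Sum>i<\<eta>. i) + (\<Sum>i<\<epsilon>. \<eta> + i)"
      by (induction \<epsilon>) simp_all
    finally have 1: "(\<Sum>i<\<eta> + \<epsilon>. min i ?N) = (\<Sum>i<\<eta>. i) + (\<Sum>i<\<epsilon>. \<eta> + i)" .
    have 2: "(\<Sum>i<\<epsilon>. min (\<eta> + i) ?N) = (\<Sum>i<\<epsilon>. \<eta> + i)"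
      by (intro sum.cong) auto
    have "(\<Sum>i<\<eta>. min (\<epsilon> + i) ?N) = (\<Sum>i<\<eta>. \<epsilon> + i)"
      by (intro sum.cong) auto
    also have "\<dots> = \<eta> * \<epsilon> + (\<Sum>i<\<eta>. i)"
      by (simp only: sum.distrib) simp
    finally show ?thesis
      using 1 2 by simp
  qed
  have "(\<Sum>i<\<epsilon>. min (\<eta> + i) ?N) + (\<Sum>i<\<eta> + a. min (\<epsilon> + i) ?N) = \<eta> * \<epsilon> + (\<Sum>i<\<eta> + a + \<epsilon>. min i ?N)"
    by (induction a) (use base in simp_all)
  then show ?thesis
    unfolding ab by (induction b) simp_all
qed

lemma sum_split_at: "(\<Sum>i<d + e. f i) = (\<Sum>i<e. f i) + (\<Sum>i<d. f (e + i))" for f :: "nat \<Rightarrow> nat"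
  by (induction d) (simp_all add: ac_simps)

text \<open>
  The weight of the row \<open>i\<close> in the column \<open>j\<close> of the Sylvester matrix is a truncated difference of a potential
  of the row and \<open>j\<close>. It is at least the signed difference of the two values capped at \<open>\<eta> + \<epsilon>\<close>, and the sum of
  these signed differences does not depend on the permutation.
\<close>

lemma permutation_weight_ge:
  fixes \<eta> \<epsilon> :: nat
  assumes "\<eta> \<le> d" and "\<epsilon> \<le> e" and \<sigma>: "\<sigma> permutes {0..<d + e}"
  shows "\<eta> * \<epsilon> \<le> (\<Sum>i<d + e. (if i < e then \<eta> + i else \<epsilon> + (i - e)) - \<sigma> i)"
proof -
  let ?\<rho> = "\<lambda>i. if i < e then \<eta> + i else \<epsilon> + (i - e)"
  let ?N = "\<eta> + \<epsilon>"
  have "(\<Sum>i<d + e. min (?\<rho> i) ?N) \<le> (\<Sum>i<d + e. (?\<rho> i - \<sigma> i) + min (\<sigma> i) ?N)"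
    by (intro sum_mono) auto
  also have "\<dots> = (\<Sum>i<d + e. ?\<rho> i - \<sigma> i) + (\<Sum>i<d + e. min (\<sigma> i) ?N)"
    by (rule sum.distrib)
  also have "(\<Sum>i<d + e. min (\<sigma> i) ?N) = (\<Sum>i<d + e. min i ?N)"
    using sum.permute[OF \<sigma>, of "\<lambda>i. min i ?N"] by (simp add: lessThan_atLeast0 o_def)
  also have "(\<Sum>i<d + e. min (?\<rho> i) ?N) = \<eta> * \<epsilon> + (\<Sum>i<d + e. min i ?N)"
    unfolding sum_split_at[of "\<lambda>i. min (?\<rho> i) ?N"] using sum_min_identity[OF assms(1,2)] by simp
  finally show ?thesis
    by simp
qed

text \<open>
  In the generic case \<open>\<eta>\<close> roots of \<open>f\<close> and \<open>\<epsilon>\<close> roots of \<open>g\<close> tend to infinity with order one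
  at \<open>t = 0\<close>, and each pair of them contributes one factor \<open>t\<close>. In general every single term of the
  Leibniz formula is divisible by that power, by the preceding count of weights.
\<close>

lemma power_dvd_resultant_sub:
  fixes t :: "'a::comm_ring_1"
  assumes \<eta>: "\<eta> \<le> d" and \<epsilon>: "\<epsilon> \<le> e"
    and f: "\<And>c. c \<le> d \<Longrightarrow> t ^ (\<eta> - c) dvd coeff f (d - c)"
    and g: "\<And>c. c \<le> e \<Longrightarrow> t ^ (\<epsilon> - c) dvd coeff g (e - c)"
  shows "t ^ (\<eta> * \<epsilon>) dvd resultant_sub d e f g"
proof -
  interpret multiplicative_grading "\<lambda>n. {r. t ^ n dvd r}"
    by unfold_locales (auto simp: power_add mult_dvd_mono)
  define w where "w = (\<lambda>i j. (if i < e then \<eta> + i else \<epsilon> + (i - e)) - j)"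
  have "sylvester_mat_sub d e f g $$ (i, j) \<in> {r. t ^ w i j dvd r}" if ij: "i < d + e" "j < d + e" for i j
  proof (cases "i < e")
    case True
    have "d + i - j = d - (j - i)" "\<eta> + i - j = \<eta> - (j - i)" if "i \<le> j"
      using that by auto
    then show ?thesis
      using True ij f[of "j - i"] by (auto simp: sylvester_mat_sub_index w_def)
  next
    case False
    have "i - j = e - (j - (i - e))" "\<epsilon> + (i - e) - j = \<epsilon> - (j - (i - e))" "j - (i - e) \<le> e"
      if "i - e \<le> j" "j \<le> i"
      using that False by auto
    then show ?thesis
      using False ij g[of "j - (i - e)"] by (auto simp: sylvester_mat_sub_index w_def)
  qed
  moreover have "{r. t ^ (\<Sum>i<d + e. w i (\<sigma> i)) dvd r} \<subseteq> {r. t ^ (\<eta> * \<epsilon>) dvd r}"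
    if "\<sigma> permutes {0..<d + e}" for \<sigma>
    using le_imp_power_dvd[OF permutation_weight_ge[OF \<eta> \<epsilon> that], of t]
    by (auto simp: w_def intro: dvd_trans)
  ultimately have "det (sylvester_mat_sub d e f g) \<in> {r. t ^ (\<eta> * \<epsilon>) dvd r}"
    by (intro det_mem[of _ "d + e" w]) auto
  then show ?thesis
    by (simp add: resultant_sub_def)
qed

text \<open>
  A monomial in the coefficient of $z^l$ has order at least \<open>\<eta>\<close>, of which $z^l$ accounts for \<open>l\<close>.
\<close>

lemma x_power_dvd_slice:
  fixes H :: "'a::field poly3"
  assumes "transversal_order_ge \<eta> H"
  shows "[:[:0, 1:]:] ^ (\<eta> - l) dvd coeff H l"
proof -
  have "coeff (coeff (coeff H l) j) i = 0" if "i < \<eta> - l" for i j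
    using assms that unfolding transversal_order_ge_def coeff3_def by (metis less_diff_conv not_le)
  then have "[:monom 1 (\<eta> - l):] dvd coeff H l"
    by (simp add: const_poly_dvd_iff monom_1_dvd_iff')
  then show ?thesis
    by (simp add: poly_const_pow monom_altdef)
qed

text \<open>
  At a point with $z = 0$ only the leading coefficient of \<open>ray F\<close> survives, and it takes the value of
  \<open>F\<close> at the point.
\<close>

lemma map_poly_ray_at_infinity:
  fixes F :: "'a::field poly3"
  assumes on: "on_curve F (p, q, 0)" and F: "homogeneous d F"
  shows "map_poly (\<lambda>r. subst3 (\<lambda>t. t) r p q 0) (ray F) = 0"
proof -
  let ?h = "\<lambda>r :: 'a poly3. subst3 (\<lambda>t. t) r p q 0"
  interpret h: comm_ring_hom ?h
    by (intro comm_ring_hom_subst3 comm_ring_hom_ident)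
  have z: "?h varz = 0"
    by (rule subst3_basic[OF comm_ring_hom_ident])
  have top: "?h [:coeff F 0:] = 0"
  proof -
    obtain c F' where F': "F = pCons c F'"
      by (cases F)
    then have "F = [:coeff F 0:] + varz * F'"
      by simp
    then have "?h F = ?h [:coeff F 0:] + ?h varz * ?h F'"
      by (metis h.hom_add h.hom_mult)
    then show ?thesis
      using on z by (simp add: on_curve_def)
  qed
  have "?h (coeff (ray F) k) = 0" for k
  proof (cases "k < d")
    case True
    then have "coeff (ray F) k = [:coeff F (d - k):] * varz ^ (d - k)"
      unfolding coeff_ray[OF F] power_z by (simp add: smult_monom)
    then have "?h (coeff (ray F) k) = ?h [:coeff F (d - k):] * ?h varz ^ (d - k)"
      by (simp only: h.hom_mult h.hom_power)
    then show ?thesis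
      using True unfolding z by simp
  next
    case False
    then show ?thesis
      using top by (cases "k = d") (simp_all add: coeff_ray[OF F] monom_0)
  qed
  then show ?thesis
    by (intro poly_eqI) (simp add: coeff_map_poly)
qed

lemma on_curve_imp_degree_pos:
  fixes F :: "'a::field poly3"
  assumes on: "on_curve F (p, q, r)" and F: "homogeneous d F" "F \<noteq> 0"
  shows "d > 0"
proof (rule ccontr)
  assume "\<not> d > 0"
  then have "coeff3 F i j l = 0" if "\<not> (i = 0 \<and> j = 0 \<and> l = 0)" for i j l
    using F(1) that unfolding homogeneous_def by fastforce
  then have "F = const3 (coeff3 F 0 0 0)"
    by (intro coeff3_eqI) (auto simp: coeff3_def coeff_pCons split: nat.splits)
  moreover from this have "coeff3 F 0 0 0 \<noteq> 0"
    using F(2) by auto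
  moreover have "subst3 (\<lambda>t. t) (const3 (coeff3 F 0 0 0)) p q r = coeff3 F 0 0 0"
    by (rule subst3_basic[OF comm_ring_hom_ident])
  ultimately show False
    using on unfolding on_curve_def by simp
qed

lemma on_curve_conchoidal_form:
  fixes F G :: "'a::field poly3"
  assumes F: "homogeneous d F" "F \<noteq> 0" and G: "homogeneous e G" "G \<noteq> 0"
    and on: "on_curve F (p, q, 0)" "on_curve G (p, q, 0)"
  shows "on_curve (conchoidal_form d e F G) (p, q, 0)"
proof -
  let ?h = "\<lambda>r :: 'a poly3. subst3 (\<lambda>t. t) r p q 0"
  have hom: "comm_ring_hom ?h"
    by (intro comm_ring_hom_subst3 comm_ring_hom_ident)
  interpret h: comm_ring_hom ?h
    by (rule hom)
  (* at the point both polynomials vanish identically, hence so does the whole matrix *)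
  have "sylvester_mat_sub d e (0 :: 'a poly) 0 = 0\<^sub>m (d + e) (d + e)"
    by (intro eq_matI) (auto simp: sylvester_mat_sub_index)
  moreover have "det (0\<^sub>m (d + e) (d + e) :: 'a mat) = 0"
    using on_curve_imp_degree_pos[OF on(1) F] by (intro det_zero) simp
  ultimately have "resultant_sub d e (0 :: 'a poly) 0 = 0"
    by (simp add: resultant_sub_def)
  then have "?h (conchoidal_form d e F G) = 0"
    unfolding conchoidal_form_eq_resultant resultant_sub_map_poly[OF hom] map_poly_flip[OF hom]
      map_poly_ray_at_infinity[OF on(1) F(1)] map_poly_ray_at_infinity[OF on(2) G(1)]
    by simp
  then show ?thesis
    by (simp add: on_curve_def)
qed

lemma map_poly_slice:
  assumes "comm_ring_hom h"
  shows "map_poly h (monom (coeff F l) l) = monom (coeff (map_poly h F) l) l"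
proof -
  interpret comm_ring_hom h by fact
  show ?thesis by simp
qed

text \<open>
  The coefficients of both polynomials inherit the order of the curves at the point; the resultant has
  degree \<open>e\<close> in those of the first and \<open>d\<close> in those of the second.
\<close>

lemma transversal_order_conchoidal_form:
  fixes F G :: "'a::field poly3" and h :: "'a poly poly \<Rightarrow> 'a poly poly"
  assumes F: "homogeneous d F" and G: "homogeneous e G"
    and h: "comm_ring_hom h"
    and \<eta>: "transversal_order_ge \<eta> (map_poly h F)" and \<epsilon>: "transversal_order_ge \<epsilon> (map_poly h G)"
  shows "transversal_order_ge (\<eta> * e + \<epsilon> * d) (map_poly h (conchoidal_form d e F G))"
proof -
  interpret h: map_poly_comm_ring_hom h
    by (intro map_poly_comm_ring_hom.intro h)
  have hom: "comm_ring_hom (map_poly h)"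
    by unfold_locales
  interpret hh: comm_ring_hom "map_poly h"
    by (rule hom)
  interpret multiplicative_grading "\<lambda>n. {H :: 'a poly3. transversal_order_ge n H}"
    by (rule multiplicative_grading_transversal)
  have ray: "coeff (map_poly (map_poly h) (ray H)) k \<in> {H. transversal_order_ge n H}"
    if H: "homogeneous m H" and n: "transversal_order_ge n (map_poly h H)" for H :: "'a poly3" and m n k
  proof -
    have eq: "map_poly h (coeff (ray H) k) = (if k \<le> m then monom (coeff (map_poly h H) (m - k)) (m - k) else 0)"
      unfolding coeff_ray[OF H] using map_poly_slice[OF h] by simp
    have "transversal_order_ge n (map_poly h (coeff (ray H) k))"
      unfolding transversal_order_ge_def
    proof (intro allI impI)
      fix i j l assume "coeff3 (map_poly h (coeff (ray H) k)) i j l \<noteq> 0"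
      then have "coeff3 (map_poly h H) i j l \<noteq> 0"
        unfolding eq by (auto simp only: coeff3_monom_slice coeff3_0 split: if_splits)
      then show "n \<le> i + l"
        using n unfolding transversal_order_ge_def by blast
    qed
    then show ?thesis
      by (simp add: coeff_map_poly)
  qed
  have "map_poly h (conchoidal_form d e F G) \<in> {H. transversal_order_ge (e * \<eta> + d * \<epsilon>) H}"
    unfolding conchoidal_form_eq_resultant resultant_sub_map_poly[OF hom] map_poly_flip[OF hom]
    by (intro resultant_sub_mem coeff_flip_mem ray[OF F \<eta>] ray[OF G \<epsilon>])
  then show ?thesis
    by (simp add: mult.commute)
qed

text \<open>
  The flip preserves divisibility of the coefficients by decreasing powers of \<open>u\<close>, because it lets the
  coefficient of $\lambda^{d-c}$ depend only on coefficients of $\lambda^{d-l}$ with $l \le c$.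
\<close>

lemma power_dvd_conchoidal_form_at_infinity:
  fixes F G :: "'a::field poly3"
  assumes F: "homogeneous d F" and G: "homogeneous e G" and le: "\<eta> \<le> d" "\<epsilon> \<le> e"
    and \<eta>: "\<And>l. u ^ (\<eta> - l) dvd coeff F l" and \<epsilon>: "\<And>l. u ^ (\<epsilon> - l) dvd coeff G l"
  shows "[:u:] ^ (\<eta> * \<epsilon>) dvd conchoidal_form d e F G"
proof -
  have slice: "[:u:] ^ (n - c) dvd monom (coeff H l) l"
    if "\<And>l. u ^ (n - l) dvd coeff H l" "l \<le> c" for H :: "'a poly3" and n c l
  proof -
    have "u ^ (n - c) dvd coeff H l"
      by (rule dvd_trans[OF le_imp_power_dvd that(1)]) (use that(2) in simp)
    then show ?thesis
      unfolding poly_const_pow const_poly_dvd_iff by simp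
  qed
  have "[:u:] ^ (\<eta> - c) dvd coeff (ray F \<circ>\<^sub>p [:1, - 1:]) (d - c)" for c
    unfolding coeff_flip
  proof (intro dvd_sum)
    fix m
    show "[:u:] ^ (\<eta> - c) dvd coeff (ray F) m * coeff ([:1, - 1:] ^ m) (d - c)"
    proof (cases "d - c \<le> m \<and> m \<le> d")
      case True
      then show ?thesis
        unfolding coeff_ray[OF F] using slice[OF \<eta>, of "d - m" c] by (intro dvd_mult2) auto
    next
      case False
      have "degree ([:1, - 1:] ^ m :: 'a poly3 poly) \<le> m"
        by (rule degree_flip_power)
      then have "coeff (ray F) m * coeff ([:1, - 1:] ^ m) (d - c) = 0"
        using False by (auto simp: coeff_ray[OF F] not_le intro!: coeff_eq_0)
      then show ?thesis
        by (simp only: dvd_0_right)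
    qed
  qed
  moreover have "[:u:] ^ (\<epsilon> - c) dvd coeff (ray G) (e - c)" if "c \<le> e" for c
    unfolding coeff_ray[OF G] using slice[OF \<epsilon>, of c c] that by simp
  ultimately show ?thesis
    unfolding conchoidal_form_eq_resultant by (intro power_dvd_resultant_sub le)
qed

text \<open>
  Both bounds are read off in coordinates adapted to the point. The bound for the multiplicity needs that the
  conchoidal form is nonzero, so that its order is attained by some monomial. The bound for the line needs
  that the multiplicities of the two curves are at most their degrees, so that the corner of the Sylvester matrix that
  carries the weights has its full size.
\<close>

lemma conchoidal_at_infinity:
  fixes F G :: "'a::field poly3"
  assumes F: "homogeneous d F" "coeff F 0 \<noteq> 0" and G: "homogeneous e G" "G \<noteq> 0"
    and pq: "(p, q) \<noteq> (0, 0)"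
  shows "mult_at F (p, q, 0) * e + mult_at G (p, q, 0) * d \<le> mult_at (conchoidal_form d e F G) (p, q, 0)"
    and "mult_at F (p, q, 0) * mult_at G (p, q, 0) \<le> conchoidal d e F G (line_through pt_A (p, q, 0))"
proof -
  obtain u v u' v' c where coordinates:
      "\<forall>r. subst2 u v (subst2 u' v' r) = r" "\<forall>r. subst2 u' v' (subst2 u v r) = r"
      "\<forall>d F. homogeneous d F \<longrightarrow> homogeneous d (map_poly (subst2 u' v') F)"
      "\<forall>d F. homogeneous d F \<longrightarrow> mult_at F (p, q, 0) = transversal_order (map_poly (subst2 u' v') F)"
    and c: "c \<noteq> 0" and line: "line_through pt_A (p, q, 0) = const3 c * [:u:]"
    using coordinates_at_infinity[OF pq] .
  note inv = coordinates(1,2)[rule_format] and hom = coordinates(3)[rule_format] and mult = coordinates(4)[rule_format]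
  let ?h = "map_poly (subst2 u' v')" and ?k = "map_poly (subst2 u v)"
  interpret k: comm_ring_hom "subst2 u v" by (rule subst2_hom)
  interpret h: comm_ring_hom "subst2 u' v'" by (rule subst2_hom)
  have kh: "?k (?h r) = r" and hk: "?h (?k r) = r" for r
    by (intro poly_eqI; simp add: inv)+
  have h0: "?h r \<noteq> 0" if "r \<noteq> 0" for r
    using kh[of r] that by auto
  let ?R = "conchoidal_form d e F G"
  have R0: "?R \<noteq> 0"
    by (rule conchoidal_form_nonzero[OF F G])
  have R: "homogeneous (2 * e * d) ?R"
    by (rule homogeneous_conchoidal_form[OF F(1) G(1)])
  have F0: "F \<noteq> 0"
    using F(2) by auto
  define \<eta> where "\<eta> = mult_at F (p, q, 0)"
  define \<epsilon> where "\<epsilon> = mult_at G (p, q, 0)"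
  have \<eta>: "transversal_order_ge \<eta> (?h F)"
    unfolding \<eta>_def mult[OF F(1)] by (rule transversal_order_ge_self)
  have \<epsilon>: "transversal_order_ge \<epsilon> (?h G)"
    unfolding \<epsilon>_def mult[OF G(1)] by (rule transversal_order_ge_self)
  have order_le: "transversal_order H \<le> n" if H: "homogeneous n H" "H \<noteq> 0" for n and H :: "'a poly3"
  proof -
    obtain i j l where "i + l = transversal_order H" "coeff3 H i j l \<noteq> 0"
      using transversal_order_attained[OF H(2)] .
    moreover from this have "i + j + l = n"
      using H(1) unfolding homogeneous_def by blast
    ultimately show ?thesis
      by simp
  qed
  have "transversal_order_ge (\<eta> * e + \<epsilon> * d) (?h ?R)"
    by (rule transversal_order_conchoidal_form[OF F(1) G(1) subst2_hom \<eta> \<epsilon>])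
  moreover obtain i j l where "i + l = transversal_order (?h ?R)" "coeff3 (?h ?R) i j l \<noteq> 0"
    using transversal_order_attained[OF h0[OF R0]] .
  ultimately have "\<eta> * e + \<epsilon> * d \<le> transversal_order (?h ?R)"
    unfolding transversal_order_ge_def by metis
  then show "mult_at F (p, q, 0) * e + mult_at G (p, q, 0) * d \<le> mult_at ?R (p, q, 0)"
    unfolding mult[OF R] \<eta>_def \<epsilon>_def .
  have slices: "u ^ (n - l) dvd coeff H l" if "transversal_order_ge n (?h H)" for n l H
  proof -
    have "subst2 u v ([:[:0, 1:]:] ^ (n - l)) dvd subst2 u v (coeff (?h H) l)"
      by (intro k.hom_dvd x_power_dvd_slice that)
    then show ?thesis
      by (simp only: k.hom_power subst2_x h.coeff_map_poly_hom inv)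
  qed
  have "\<eta> \<le> d" "\<epsilon> \<le> e"
    unfolding \<eta>_def \<epsilon>_def mult[OF F(1)] mult[OF G(1)]
    by (intro order_le hom h0 F G F0)+
  then have "[:u:] ^ (\<eta> * \<epsilon>) dvd ?R"
    by (intro power_dvd_conchoidal_form_at_infinity F G slices \<eta> \<epsilon>)
  moreover have unit: "const3 c dvd 1"
    using c by (simp add: is_unit_const_poly_iff dvd_field_iff)
  ultimately have dvd: "(const3 c * [:u:]) ^ (\<eta> * \<epsilon>) dvd ?R"
    unfolding power_mult_distrib by (subst mult_unit_dvd_iff') (rule is_unit_power_iff[THEN iffD2], auto)
  have "prime_elem (?k varx)"
    by (rule prime_elem_automorphism[OF map_poly_subst2_hom map_poly_subst2_hom kh hk prime_elem_varx])
  moreover have "?k varx = [:u:]"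
    unfolding k.map_poly_pCons_hom subst2_x by simp
  ultimately have "prime_elem (const3 c * [:u:])"
    using unit by (simp only: prime_elem_mult_unit_left)
  then show "mult_at F (p, q, 0) * mult_at G (p, q, 0) \<le> conchoidal d e F G (line_through pt_A (p, q, 0))"
    unfolding conchoidal_def line \<eta>_def[symmetric] \<epsilon>_def[symmetric]
    by (rule divisor_of_ge[OF _ R0 dvd])
qed

section \<open>The conchoidal transform\<close>

theorem theorem3p4:
  fixes F G :: "'a::field poly3" and d \<delta> :: nat
  assumes char: "CHAR('a) = 0 \<or> (CHAR('a) > d \<and> CHAR('a) > \<delta>)"
    and B: "curve d F"
    and C: "curve \<delta> G"
    and L_infty: "divisor_of F L_infty = 0"
  shows "curve (2 * \<delta> * d) (conchoidal_form d \<delta> F G) \<and>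
    conchoidal d \<delta> F G = conchoidal \<delta> d G F \<and>
    (\<forall>\<delta>\<^sub>1 \<delta>\<^sub>2 G\<^sub>1 G\<^sub>2.
       curve \<delta>\<^sub>1 G\<^sub>1 \<longrightarrow> curve \<delta>\<^sub>2 G\<^sub>2 \<longrightarrow>
       divisor_of G = (\<lambda>p. divisor_of G\<^sub>1 p + divisor_of G\<^sub>2 p) \<longrightarrow>
       conchoidal d \<delta> F G = (\<lambda>p. conchoidal d \<delta>\<^sub>1 F G\<^sub>1 p + conchoidal d \<delta>\<^sub>2 F G\<^sub>2 p)) \<and>
    (\<forall>P \<eta> \<epsilon>.
       is_point P \<longrightarrow> on_curve L_infty P \<longrightarrow> on_curve F P \<longrightarrow> on_curve G P \<longrightarrow>
       mult_at F P = \<eta> \<longrightarrow> mult_at G P = \<epsilon> \<longrightarrow>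
         on_curve (conchoidal_form d \<delta> F G) P \<and>
         mult_at (conchoidal_form d \<delta> F G) P \<ge> \<eta> * \<delta> + \<epsilon> * d \<and>
         (\<epsilon> \<le> \<eta> \<longrightarrow>
            conchoidal d \<delta> F G (line_through pt_A P)
              \<ge> \<epsilon> * (\<eta> - \<epsilon>) + (\<epsilon> * (\<epsilon> + 1)) div 2)) \<and>
    (\<forall>\<nu>. on_curve G pt_A \<longrightarrow> mult_at G pt_A = \<nu> \<longrightarrow>
       (\<lambda>p. \<nu> * divisor_of F p) \<le> conchoidal d \<delta> F G)"
proof (intro conjI allI impI)
  have F: "homogeneous d F" "F \<noteq> 0" and G: "homogeneous \<delta> G" "G \<noteq> 0"
    using B C by (auto simp: curve_def)
  have "\<not> varz dvd F"
    using divisor_of_ge[OF prime_elem_X F(2), of 1] L_infty by (auto simp: L_infty_def)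
  then have F0: "coeff F 0 \<noteq> 0"
    using dvd_iff_poly_eq_0[of 0 F] by (simp add: poly_0_coeff_0)
  let ?R = "conchoidal_form d \<delta> F G"
  have R0: "?R \<noteq> 0"
    by (rule conchoidal_form_nonzero[OF F(1) F0 G])
  show "curve (2 * \<delta> * d) ?R"
    unfolding curve_def using R0 homogeneous_conchoidal_form[OF F(1) G(1)] by blast
  show "conchoidal d \<delta> F G = conchoidal \<delta> d G F"
    using conchoidal_form_swap[OF F(1) G(1)] unfolding conchoidal_def eq_up_to_sign_def
    by (elim disjE) (simp_all only: divisor_of_uminus)
  show "conchoidal d \<delta> F G = (\<lambda>p. conchoidal d \<delta>\<^sub>1 F G\<^sub>1 p + conchoidal d \<delta>\<^sub>2 F G\<^sub>2 p)"
    if "curve \<delta>\<^sub>1 G\<^sub>1" "curve \<delta>\<^sub>2 G\<^sub>2" "divisor_of G = (\<lambda>p. divisor_of G\<^sub>1 p + divisor_of G\<^sub>2 p)"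
    for \<delta>\<^sub>1 \<delta>\<^sub>2 G\<^sub>1 G\<^sub>2
    by (rule conchoidal_add[OF F(1) F0 that(1,2) C that(3)])
  show "(\<lambda>p. \<nu> * divisor_of F p) \<le> conchoidal d \<delta> F G" if \<nu>: "mult_at G pt_A = \<nu>" for \<nu>
  proof (rule le_funI)
    fix p
    have dvd: "F ^ \<nu> dvd ?R"
      by (rule power_dvd_conchoidal_form[OF F(1) F0 G]) (use coeff3_ge_mult_at_A[OF G(1)] \<nu> in blast)
    show "\<nu> * divisor_of F p \<le> conchoidal d \<delta> F G p"
    proof (cases "prime_elem p")
      case True
      obtain n Q where n: "divisor_of F p = n" "F = p ^ n * Q" "\<not> p dvd Q"
        using divisor_of_decomp[OF True F(2)] .
      have "(p ^ n) ^ \<nu> dvd F ^ \<nu>"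
        unfolding n(2) by (intro dvd_power_same dvd_triv_left)
      then have "p ^ (\<nu> * n) dvd F ^ \<nu>"
        by (simp only: power_mult[symmetric] mult.commute)
      then have "p ^ (\<nu> * n) dvd ?R"
        using dvd by (rule dvd_trans)
      then show ?thesis
        unfolding conchoidal_def n(1) by (rule divisor_of_ge[OF True R0])
    qed (simp add: divisor_of_def)
  qed
  fix P :: "'a point" and \<eta> \<epsilon>
  assume P: "is_point P" "on_curve L_infty P" and on: "on_curve F P" "on_curve G P"
    and \<eta>: "mult_at F P = \<eta>" and \<epsilon>: "mult_at G P = \<epsilon>"
  obtain p q r where pqr: "P = (p, q, r)"
    by (cases P)
  have "r = 0"
    using P(2) subst3_basic(4)[OF comm_ring_hom_ident, where u = p and v = q and w = r] by (simp add: on_curve_def L_infty_def pqr)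
  then have pq: "P = (p, q, 0)" "(p, q) \<noteq> (0, 0)"
    using P(1) by (auto simp: pqr is_point_def)
  show "on_curve ?R P"
    using on_curve_conchoidal_form[OF F G] on unfolding pq(1) .
  show "\<eta> * \<delta> + \<epsilon> * d \<le> mult_at ?R P"
    using conchoidal_at_infinity(1)[OF F(1) F0 G pq(2)] \<eta> \<epsilon> unfolding pq(1) by simp
  assume le: "\<epsilon> \<le> \<eta>"
  (* the sharper bound eta * epsilon holds; it is at least the stated one because
     epsilon * (epsilon + 1) is at most twice the square of epsilon *)
  have "\<epsilon> * (\<epsilon> + 1) \<le> 2 * (\<epsilon> * \<epsilon>)"
    using le_square[of \<epsilon>] by simp
  then have "\<epsilon> * (\<epsilon> + 1) div 2 \<le> \<epsilon> * \<epsilon>"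
    by linarith
  then have "\<epsilon> * (\<eta> - \<epsilon>) + \<epsilon> * (\<epsilon> + 1) div 2 \<le> \<epsilon> * (\<eta> - \<epsilon>) + \<epsilon> * \<epsilon>"
    by (rule add_left_mono)
  also have "\<dots> = \<epsilon> * ((\<eta> - \<epsilon>) + \<epsilon>)"
    by (rule add_mult_distrib2[symmetric])
  also have "\<dots> = \<eta> * \<epsilon>"
    using le by (simp add: mult.commute)
  also have "\<dots> \<le> conchoidal d \<delta> F G (line_through pt_A P)"
    using conchoidal_at_infinity(2)[OF F(1) F0 G pq(2)] \<eta> \<epsilon> unfolding pq(1) by simp
  finally show "\<epsilon> * (\<eta> - \<epsilon>) + \<epsilon> * (\<epsilon> + 1) div 2 \<le> conchoidal d \<delta> F G (line_through pt_A P)" .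
qed

end
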